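(* Let $q\ge 3$ be an integer and let $k_q=q-\frac{3}{2}+\frac{h_q}{2}$, where $h_q=1+\frac12+\frac13+\cdots+\frac1q$ is the $q$th harmonic number. Then there exists $n_0$ such that the following holds for every $n>n_0$: if $G$ is a balanced $q$-partite simple graph on $qn$ vertices and $\widetilde{\delta}(G)\ge \frac{k_q}{k_q+1}$, then $G$ has a $K_q$-factor.
   Context: A simple graph $F$ is $q$-partite if its vertex set can be partitioned into $q$ classes $A_1,\dots,A_q$, each an independent set; it is balanced if all classes have the same size (here each class has $n$ vertices). For such $F$ with given classes $A_1,\dots,A_q$, the proportional minimum degree is $\widetilde{\delta}(F)=\min_{1\le i\le q}\min_{v\in A_i}\min_{j\ne i}\frac{\deg(v,A_j)}{|A_j|}$, where $\deg(v,A_j)$ is the number of neighbours of $v$ in $A_j$. For a fixed graph $J$ on $q$ vertices, a $J$-factor of $F$ (when $q$ divides $|V(F)|$) is a subgraph of $F$ consisting of $|V(F)|/q$ vertex-disjoint copies of $J$; $K_q$ denotes the complete graph on $q$ vertices. *)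

theory Defs
  imports "HOL-Analysis.Harmonic_Numbers" "Graph_Theory.Graph_Theory"
begin

text \<open>
  Simple graphs are finite symmetric loop-free digraphs (locale \<open>pair_graph\<close>): an edge
  \<open>{u, v}\<close> is represented by the two arcs \<open>(u, v)\<close> and \<open>(v, u)\<close>. Everything that depends on the
  vertex classes takes the family \<open>A\<close> explicitly, with classes \<open>A 1, \<dots>, A q\<close>.
\<close>

definition independent_set :: "'a pair_pre_digraph \<Rightarrow> 'a set \<Rightarrow> bool" where
  "independent_set F S \<longleftrightarrow> S \<subseteq> pverts F \<and> (\<forall>u\<in>S. \<forall>v\<in>S. (u, v) \<notin> parcs F)"

definition multipartite :: "'a pair_pre_digraph \<Rightarrow> nat \<Rightarrow> (nat \<Rightarrow> 'a set) \<Rightarrow> bool" where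
  "multipartite F q A \<longleftrightarrow>
     (\<Union>i\<in>{1..q}. A i) = pverts F \<and> disjoint_family_on A {1..q} \<and>
     (\<forall>i\<in>{1..q}. independent_set F (A i))"

definition balanced :: "nat \<Rightarrow> (nat \<Rightarrow> 'a set) \<Rightarrow> bool" where
  "balanced q A \<longleftrightarrow> (\<forall>i\<in>{1..q}. \<forall>j\<in>{1..q}. card (A i) = card (A j))"

definition deg_in :: "'a pair_pre_digraph \<Rightarrow> 'a \<Rightarrow> 'a set \<Rightarrow> nat" where
  "deg_in F v S = card {u \<in> S. (v, u) \<in> parcs F}"

text \<open>Meaningful only for \<open>q \<ge> 2\<close> and nonempty finite classes (\<open>Min {}\<close> is unspecified).\<close>
definition prop_min_degree :: "'a pair_pre_digraph \<Rightarrow> nat \<Rightarrow> (nat \<Rightarrow> 'a set) \<Rightarrow> real" where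
  "prop_min_degree F q A =
     (MIN i\<in>{1..q}. MIN v\<in>A i. MIN j\<in>{1..q} - {i}. real (deg_in F v (A j)) / real (card (A j)))"

definition complete_graph :: "nat \<Rightarrow> nat pair_pre_digraph" where
  "complete_graph q = \<lparr> pverts = {1..q}, parcs = {(u, v). u \<in> {1..q} \<and> v \<in> {1..q} \<and> u \<noteq> v} \<rparr>"

lemma complete_digraph_complete_graph: "complete_digraph q (with_proj (complete_graph q))"
  by (simp add: complete_digraph_pair_def complete_graph_def)

definition is_factor ::
  "'b pair_pre_digraph \<Rightarrow> 'a pair_pre_digraph \<Rightarrow> 'a pair_pre_digraph \<Rightarrow> bool" where
  "is_factor J F H \<longleftrightarrow>
     subgraph (with_proj H) (with_proj F) \<and>
     (\<exists>C. finite C \<and> card C * card (pverts J) = card (pverts F) \<and>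
        (\<forall>K\<in>C. digraph_iso (with_proj J) (with_proj K)) \<and>
        disjoint_family_on pverts C \<and>
        pverts H = (\<Union>K\<in>C. pverts K) \<and> parcs H = (\<Union>K\<in>C. parcs K))"

definition has_factor :: "'b pair_pre_digraph \<Rightarrow> 'a pair_pre_digraph \<Rightarrow> bool" where
  "has_factor J F \<longleftrightarrow> (\<exists>H. is_factor J F H)"

definition k_const :: "nat \<Rightarrow> real" where
  "k_const q = real q - 3 / 2 + harm q / 2"

end

theory Submission
  imports Defs
begin

text \<open>
  The argument works for every minimum degree ratio \<open>1 - \<kappa>\<close> with \<open>\<kappa> < 1/q\<close>; here
  \<open>\<kappa> = 1/(k\<^sub>q + 1)\<close>, and \<open>k\<^sub>q + 1 > q\<close> because the harmonic number exceeds 1.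

  \<^emph>\<open>Absorption.\<close> Two vertices of the same class have \<open>\<Omega>(n\<^sup>q\<^sup>-\<^sup>1)\<close> common
  neighbouring cliques in the other \<open>q - 1\<close> classes, as \<open>q\<close> neighbourhoods always meet in a positive
  proportion of a class. Hence each transversal can be absorbed by a positive proportion of
  the \<open>q\<times>q\<close> matrices of vertices, and a greedy choice gives linearly many disjoint matrices that
  absorb every transversal linearly often.

  \<^emph>\<open>Almost perfect tiling.\<close> If every vertex misses at most a fraction \<open>1/q\<close> of each other class,
  then for every weighting of the vertices there is a transversal clique of at most average weight:
  choose vertices greedily through the classes in cyclic order, starting from each class in turn,
  and average. Remove such cliques one by one, with weights taken from the potential
  \<open>\<Sum>exp (\<lambda> \<cdot> (proportion of class j missed by v))\<close> over all pairs \<open>v, j\<close>. A uniformly random removal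
  makes the missed proportions martingales, so the potential hardly grows, the degree condition
  survives, and the process continues until only a small fraction of each class is left for the
  absorbers.
\<close>

section \<open>Light transversal cliques\<close>

definition clique_on :: "nat \<Rightarrow> ('a \<Rightarrow> 'a \<Rightarrow> bool) \<Rightarrow> (nat \<Rightarrow> 'a) \<Rightarrow> bool" where
  "clique_on q adj K \<longleftrightarrow> (\<forall>i<q. \<forall>j<q. i \<noteq> j \<longrightarrow> adj (K i) (K j))"

lemma sorted_enumeration:
  fixes f :: "'a \<Rightarrow> real"
  assumes "finite W"
  obtains g where "bij_betw g {..<card W} W" "\<And>a b. a \<le> b \<Longrightarrow> b < card W \<Longrightarrow> f (g a) \<le> f (g b)"
proof -
  obtain ys where ys: "set ys = W" "distinct ys"
    using finite_distinct_list[OF assms] by auto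
  define xs where "xs = sort_key f ys"
  have xs: "set xs = W" "distinct xs" "sorted (map f xs)"
    using ys by (auto simp: xs_def)
  have len: "length xs = card W"
    using xs distinct_card by metis
  have "bij_betw ((!) xs) {..<card W} W"
    using bij_betw_nth[OF xs(2)] xs(1) len by simp
  moreover have "f (xs ! a) \<le> f (xs ! b)" if "a \<le> b" "b < card W" for a b
    using sorted_nth_mono[OF xs(3), of a b] that len by simp
  ultimately show ?thesis
    using that by blast
qed

text \<open>Spread each \<open>F k\<close> over a block of length \<open>q\<close>, giving the step
  function \<open>F (x div q)\<close> on \<open>q * m\<close> points. Regrouped into
  \<open>q\<close> blocks of length \<open>m\<close>, block \<open>p\<close> starts at
  \<open>p * m\<close>, so by monotonicity all of its values are at least
  \<open>F (p * m div q)\<close>.\<close>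

lemma left_riemann_sum_le:
  fixes F :: "nat \<Rightarrow> real"
  assumes mono: "\<And>a b. a \<le> b \<Longrightarrow> b < m \<Longrightarrow> F a \<le> F b" and "q > 0"
  shows "real m * (\<Sum>p<q. F (p * m div q)) \<le> real q * (\<Sum>k<m. F k)"
proof -
  have "real m * (\<Sum>p<q. F (p * m div q)) = (\<Sum>p<q. \<Sum>x\<in>{p * m..<p * m + m}. F (p * m div q))"
    by (simp add: sum_distrib_left)
  also have "\<dots> \<le> (\<Sum>p<q. \<Sum>x\<in>{p * m..<p * m + m}. F (x div q))"
  proof (intro sum_mono mono)
    fix p x assume "p \<in> {..<q}" and x: "x \<in> {p * m..<p * m + m}"
    then have "(p + 1) * m \<le> q * m"
      by (intro mult_right_mono) auto
    with x have "x < m * q"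
      by (simp add: algebra_simps)
    then show "x div q < m"
      by (simp add: less_mult_imp_div_less)
    show "p * m div q \<le> x div q"
      using x by (intro div_le_mono) auto
  qed
  also have "\<dots> = (\<Sum>x<q * m. F (x div q))"
    by (rule sum.nat_group)
  also have "\<dots> = (\<Sum>x<m * q. F (x div q))"
    by (simp add: mult.commute)
  also have "\<dots> = (\<Sum>k<m. \<Sum>x\<in>{k * q..<k * q + q}. F (x div q))"
    by (rule sum.nat_group[symmetric])
  also have "\<dots> = (\<Sum>k<m. \<Sum>x\<in>{k * q..<k * q + q}. F k)"
  proof (intro sum.cong refl)
    fix k x assume "x \<in> {k * q..<k * q + q}"
    then have "x div q = k"
      by (intro div_nat_eqI) (auto simp: algebra_simps)
    then show "F (x div q) = F k" by simp
  qed
  also have "\<dots> = real q * (\<Sum>k<m. F k)"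
    by (simp add: sum_distrib_left)
  finally show ?thesis .
qed

lemma bij_betw_add_mod:
  "bij_betw (\<lambda>s::nat. (s + p) mod q) {..<q} {..<q}"
proof -
  have inj: "inj_on (\<lambda>s. (s + p) mod q) {..<q}"
  proof (rule inj_onI)
    fix s t assume "s \<in> {..<q}" "t \<in> {..<q}" "(s + p) mod q = (t + p) mod q"
    then have "(int s + int p) mod int q = (int t + int p) mod int q"
      by (metis of_nat_add of_nat_mod)
    then have "int s mod int q = int t mod int q"
      by (metis add_diff_cancel_right' mod_diff_left_eq)
    then show "s = t"
      using \<open>s \<in> _\<close> \<open>t \<in> _\<close> by simp
  qed
  show ?thesis
    unfolding bij_betw_def
  proof (intro conjI inj endo_inj_surj)
    show "(\<lambda>s. (s + p) mod q) ` {..<q} \<subseteq> {..<q}" by auto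
  qed auto
qed

text \<open>Visit the classes in the order \<open>\<pi>\<close>. At position \<open>p\<close> the
  \<open>p\<close> vertices already chosen exclude at most \<open>p * m / q\<close> vertices, so one
  of the \<open>p * m div q + 1\<close> lightest vertices of the class is still available.\<close>

lemma greedy_clique_along_order:
  fixes W :: "nat \<Rightarrow> 'a set" and \<pi> :: "nat \<Rightarrow> nat"
  assumes fin: "\<And>j. j < q \<Longrightarrow> finite (W j)" and "m > 0"
    and sym: "\<And>u v. adj u v \<Longrightarrow> adj v u"
    and nonadj: "\<And>i j v. i < q \<Longrightarrow> j < q \<Longrightarrow> i \<noteq> j \<Longrightarrow> v \<in> W i \<Longrightarrow> q * card {u \<in> W j. \<not> adj v u} \<le> m"
    and enum: "\<And>j. j < q \<Longrightarrow> bij_betw (g j) {..<m} (W j)"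
    and mono: "\<And>j a b. j < q \<Longrightarrow> a \<le> b \<Longrightarrow> b < m \<Longrightarrow> f j (g j a) \<le> f j (g j b :: 'a)"
    and perm: "bij_betw \<pi> {..<q} {..<q}"
  shows "\<exists>K. clique_on q adj K \<and> (\<forall>j<q. K j \<in> W j) \<and>
    (\<Sum>j<q. f j (K j)) \<le> (\<Sum>p<q. f (\<pi> p) (g (\<pi> p) (p * m div q)) :: real)"
proof -
  have \<pi>: "\<pi> p < q" if "p < q" for p
    using perm that by (auto simp: bij_betw_def)
  have \<pi>_neq: "\<pi> p \<noteq> \<pi> p'" if "p < q" "p' < q" "p \<noteq> p'" for p p'
    using perm that by (auto simp: bij_betw_def dest: inj_onD)
  have "\<exists>L. (\<forall>p<k. L p \<in> W (\<pi> p) \<and> f (\<pi> p) (L p) \<le> f (\<pi> p) (g (\<pi> p) (p * m div q))) \<and>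
         (\<forall>p<k. \<forall>p'<k. p \<noteq> p' \<longrightarrow> adj (L p) (L p'))" if "k \<le> q" for k
    using that
  proof (induction k)
    case 0
    then show ?case by simp
  next
    case (Suc k)
    then have "k \<le> q" by simp
    from Suc.IH[OF this] obtain L where L: "\<And>p. p < k \<Longrightarrow> L p \<in> W (\<pi> p)"
      "\<And>p. p < k \<Longrightarrow> f (\<pi> p) (L p) \<le> f (\<pi> p) (g (\<pi> p) (p * m div q))"
      "\<And>p p'. p < k \<Longrightarrow> p' < k \<Longrightarrow> p \<noteq> p' \<Longrightarrow> adj (L p) (L p')"
      by blast
    define j where "j = \<pi> k"
    have kq: "k < q" using Suc.prems by simp
    have j: "j < q" using \<pi> kq by (simp add: j_def)
    have km: "k * m div q < m"
      using kq \<open>m > 0\<close> by (simp add: less_mult_imp_div_less)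
    define bad where "bad = (\<Union>p<k. {u \<in> W j. \<not> adj (L p) u})"
    define low where "low = g j ` {..k * m div q}"
    have "q * card bad \<le> q * (\<Sum>p<k. card {u \<in> W j. \<not> adj (L p) u})"
      unfolding bad_def by (intro mult_left_mono card_UN_le) auto
    also have "\<dots> = (\<Sum>p<k. q * card {u \<in> W j. \<not> adj (L p) u})"
      by (simp add: sum_distrib_left)
    also have "\<dots> \<le> (\<Sum>p<k. m)"
    proof (intro sum_mono)
      fix p assume "p \<in> {..<k}"
      then show "q * card {u \<in> W j. \<not> adj (L p) u} \<le> m"
        using kq j \<pi>[of p] L(1) \<pi>_neq[of p k] nonadj[of "\<pi> p" j "L p"] by (auto simp: j_def)
    qed
    finally have bad: "q * card bad \<le> k * m" by simp
    have "inj_on (g j) {..k * m div q}"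
      using enum[OF j] km by (auto simp: bij_betw_def intro: inj_on_subset)
    then have "card low = Suc (k * m div q)"
      by (simp add: low_def card_image)
    \<comment> \<open>\<open>low\<close> includes the index \<open>k * m div q\<close> itself, so it
      has more than \<open>k * m / q\<close> elements, while \<open>bad\<close> has at most that
      many.\<close>
    then have "k * m < q * card low"
      using kq by (metis dividend_less_times_div mult_Suc_right add.commute gr0I not_less0)
    with bad have "card bad < card low"
      by (metis le_less_trans mult_less_cancel1)
    moreover have "finite bad"
      using fin[OF j] by (auto simp: bad_def)
    ultimately obtain u where u: "u \<in> low" "u \<notin> bad"
      by (metis card_mono not_less subsetI)
    then obtain a where a: "a \<le> k * m div q" "u = g j a"
      by (auto simp: low_def)
    have uW: "u \<in> W j"
      using enum[OF j] a km by (auto simp: bij_betw_def)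
    have adj: "adj (L p) u" "adj u (L p)" if "p < k" for p
      using u(2) uW that sym by (auto simp: bad_def)
    have fu: "f j u \<le> f j (g j (k * m div q))"
      using mono[OF j a(1) km] a(2) by simp
    show ?case
    proof (intro exI[of _ "L(k := u)"] conjI allI impI)
      fix p assume "p < Suc k"
      then show "(L(k := u)) p \<in> W (\<pi> p)"
        "f (\<pi> p) ((L(k := u)) p) \<le> f (\<pi> p) (g (\<pi> p) (p * m div q))"
        using L fu uW by (auto simp: j_def less_Suc_eq)
    next
      fix p p' assume "p < Suc k" "p' < Suc k" "p \<noteq> p'"
      then show "adj ((L(k := u)) p) ((L(k := u)) p')"
        using L(3) adj by (auto simp: less_Suc_eq)
    qed
  qed
  from this[of q] obtain L where L: "\<And>p. p < q \<Longrightarrow> L p \<in> W (\<pi> p)"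
      "\<And>p. p < q \<Longrightarrow> f (\<pi> p) (L p) \<le> f (\<pi> p) (g (\<pi> p) (p * m div q))"
      "\<And>p p'. p < q \<Longrightarrow> p' < q \<Longrightarrow> p \<noteq> p' \<Longrightarrow> adj (L p) (L p')"
    by auto
  \<comment> \<open>\<open>L\<close> is indexed by positions in the order, whereas the clique must
    be indexed by classes; \<open>\<rho>\<close> converts.\<close>
  define \<rho> where "\<rho> = inv_into {..<q} \<pi>"
  have \<rho>: "\<rho> j < q" "\<pi> (\<rho> j) = j" if "j < q" for j
    using perm that inv_into_into[of j \<pi> "{..<q}"] f_inv_into_f[of j \<pi> "{..<q}"]
    by (auto simp: \<rho>_def bij_betw_def)
  have \<rho>\<pi>: "\<rho> (\<pi> p) = p" if "p < q" for p
    using perm that by (auto simp: \<rho>_def bij_betw_def)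
  show ?thesis
  proof (intro exI[of _ "L \<circ> \<rho>"] conjI allI impI)
    show "clique_on q adj (L \<circ> \<rho>)"
      unfolding clique_on_def using L(3) \<rho> by (metis comp_apply)
    show "(L \<circ> \<rho>) j \<in> W j" if "j < q" for j
      using L(1) \<rho> that by (metis comp_apply)
    have "(\<Sum>j<q. f j ((L \<circ> \<rho>) j)) = (\<Sum>p<q. f (\<pi> p) (L p))"
      using sum.reindex_bij_betw[OF perm, of "\<lambda>j. f j ((L \<circ> \<rho>) j)"] \<rho>\<pi> by simp
    also have "\<dots> \<le> (\<Sum>p<q. f (\<pi> p) (g (\<pi> p) (p * m div q)))"
      using L(2) by (intro sum_mono) auto
    finally show "(\<Sum>j<q. f j ((L \<circ> \<rho>) j)) \<le> \<dots>" .
  qed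
qed

text \<open>Run the greedy choice for each of the \<open>q\<close> cyclic orders. Over all of them
  every class takes every position exactly once, so the bounds add up to one left Riemann sum per
  class, which is at most \<open>q\<close> times the average of that class. Some order therefore
  does no worse than the mean.\<close>

lemma clique_weight_le_average:
  fixes W :: "nat \<Rightarrow> 'a set" and f :: "nat \<Rightarrow> 'a \<Rightarrow> real"
  assumes fin: "\<And>j. j < q \<Longrightarrow> finite (W j)" and cardW: "\<And>j. j < q \<Longrightarrow> card (W j) = m"
    and "m > 0" "q > 0"
    and sym: "\<And>u v. adj u v \<Longrightarrow> adj v u"
    and nonadj: "\<And>i j v. i < q \<Longrightarrow> j < q \<Longrightarrow> i \<noteq> j \<Longrightarrow> v \<in> W i \<Longrightarrow> q * card {u \<in> W j. \<not> adj v u} \<le> m"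
  shows "\<exists>K. clique_on q adj K \<and> (\<forall>j<q. K j \<in> W j) \<and>
    (\<Sum>j<q. f j (K j)) \<le> (\<Sum>j<q. (\<Sum>u\<in>W j. f j u) / m)"
proof -
  have "\<exists>h. bij_betw h {..<m} (W j) \<and> (\<forall>a b. a \<le> b \<longrightarrow> b < m \<longrightarrow> f j (h a) \<le> f j (h b))"
    if "j < q" for j
    using sorted_enumeration[OF fin[OF that], of "f j"] cardW[OF that] by metis
  then obtain g where g: "\<And>j. j < q \<Longrightarrow> bij_betw (g j) {..<m} (W j)"
      "\<And>j a b. j < q \<Longrightarrow> a \<le> b \<Longrightarrow> b < m \<Longrightarrow> f j (g j a) \<le> f j (g j b)"
    by metis
  define b where "b j p = f j (g j (p * m div q))" for j p
  have "\<exists>K. clique_on q adj K \<and> (\<forall>j<q. K j \<in> W j) \<and>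
      (\<Sum>j<q. f j (K j)) \<le> (\<Sum>p<q. b ((p + s) mod q) p)" for s
    unfolding b_def
    by (rule greedy_clique_along_order[where W = W and f = f and g = g, OF fin \<open>m > 0\<close> sym nonadj g bij_betw_add_mod])
  then obtain K where K: "\<And>s. clique_on q adj (K s)" "\<And>s j. j < q \<Longrightarrow> K s j \<in> W j"
      "\<And>s. (\<Sum>j<q. f j (K s j)) \<le> (\<Sum>p<q. b ((p + s) mod q) p)"
    by metis
  let ?avg = "\<Sum>j<q. (\<Sum>u\<in>W j. f j u) / m"
  have "(\<Sum>s<q. \<Sum>j<q. f j (K s j)) \<le> (\<Sum>s<q. \<Sum>p<q. b ((s + p) mod q) p)"
    using K(3) by (subst add.commute) (rule sum_mono)
  also have "\<dots> = (\<Sum>p<q. \<Sum>s<q. b ((s + p) mod q) p)"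
    by (rule sum.swap)
  also have "\<dots> = (\<Sum>p<q. \<Sum>j<q. b j p)"
    by (intro sum.cong refl sum.reindex_bij_betw[OF bij_betw_add_mod])
  also have "\<dots> = (\<Sum>j<q. \<Sum>p<q. b j p)"
    by (rule sum.swap)
  also have "\<dots> \<le> (\<Sum>j<q. real q * ((\<Sum>u\<in>W j. f j u) / m))"
  proof (intro sum_mono)
    fix j assume "j \<in> {..<q}"
    then have "real m * (\<Sum>p<q. b j p) \<le> real q * (\<Sum>k<m. f j (g j k))"
      unfolding b_def using g(2) \<open>q > 0\<close> by (intro left_riemann_sum_le) auto
    also have "(\<Sum>k<m. f j (g j k)) = (\<Sum>u\<in>W j. f j u)"
      using g(1) \<open>j \<in> _\<close> by (intro sum.reindex_bij_betw) auto
    finally show "(\<Sum>p<q. b j p) \<le> real q * ((\<Sum>u\<in>W j. f j u) / m)"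
      using \<open>m > 0\<close> by (simp add: field_simps)
  qed
  also have "\<dots> = (\<Sum>s<q. ?avg)"
    by (simp add: sum_distrib_left)
  finally have "\<exists>s<q. (\<Sum>j<q. f j (K s j)) \<le> ?avg"
    using sum_strict_mono[of "{..<q}" "\<lambda>s. ?avg" "\<lambda>s. \<Sum>j<q. f j (K s j)"] \<open>q > 0\<close>
    by (metis (no_types, lifting) empty_iff finite_lessThan lessThan_iff not_le)
  then show ?thesis
    using K by blast
qed

section \<open>Almost perfect tilings\<close>

text \<open>Partition into transversal cliques. Adding one clique at a time matches both the removal
  process and absorption; the side condition \<open>K i \<notin> W' i\<close> encodes disjointness,
  and values at indices from \<open>q\<close> on are left free.\<close>

inductive tileable :: "nat \<Rightarrow> ('a \<Rightarrow> 'a \<Rightarrow> bool) \<Rightarrow> (nat \<Rightarrow> 'a set) \<Rightarrow> bool" for q adj where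
  empty: "(\<And>i. i < q \<Longrightarrow> W i = {}) \<Longrightarrow> tileable q adj W"
| insert: "tileable q adj W' \<Longrightarrow> clique_on q adj K \<Longrightarrow> (\<And>i. i < q \<Longrightarrow> K i \<notin> W' i) \<Longrightarrow>
    (\<And>i. i < q \<Longrightarrow> W i = insert (K i) (W' i)) \<Longrightarrow> tileable q adj W"

text \<open>The minimum degree condition with ratio \<open>1 - \<kappa>\<close>, phrased by
  non-neighbours because the arguments count forbidden vertices. Classes are numbered from 0
  here.\<close>

definition dense_multipartite :: "nat \<Rightarrow> ('a \<Rightarrow> 'a \<Rightarrow> bool) \<Rightarrow> (nat \<Rightarrow> 'a set) \<Rightarrow> nat \<Rightarrow> real \<Rightarrow> bool" where
  "dense_multipartite q adj V n \<kappa> \<longleftrightarrow>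
     (\<forall>j<q. finite (V j) \<and> card (V j) = n) \<and> (\<forall>u v. adj u v \<longrightarrow> adj v u) \<and>
     (\<forall>i<q. \<forall>j<q. i \<noteq> j \<longrightarrow> (\<forall>v\<in>V i. real (card {u \<in> V j. \<not> adj v u}) \<le> \<kappa> * real n))"

section \<open>Exponential potential and the clique removal process\<close>

text \<open>\<open>(1 - x + x\<^sup>2) * (1 + x) = 1 + x\<^sup>3\<close> is at least 1, and
  \<open>1 + x\<close> is at most \<open>exp x\<close>.\<close>

lemma exp_minus_le_quadratic:
  fixes x :: real
  assumes "0 \<le> x"
  shows "exp (- x) \<le> 1 - x + x\<^sup>2"
proof -
  have "1 \<le> (1 - x + x\<^sup>2) * (1 + x)"
    using assms by (simp add: algebra_simps power2_eq_square)
  also have "\<dots> \<le> (1 - x + x\<^sup>2) * exp x"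
  proof (rule mult_left_mono)
    have "0 \<le> (1 - x / 2)\<^sup>2 + 3 / 4 * x\<^sup>2" by simp
    also have "\<dots> = 1 - x + x\<^sup>2"
      by (simp add: power2_eq_square algebra_simps)
    finally show "0 \<le> 1 - x + x\<^sup>2" .
  qed simp
  finally show ?thesis
    by (simp add: exp_minus field_simps)
qed

text \<open>Deleting a uniformly random point of \<open>W\<close> leaves the density of \<open>P\<close> a martingale; this is
  the corresponding exponential moment bound.\<close>
lemma sum_exp_card_delete_le:
  fixes \<theta> :: real
  assumes "finite W" "card W = m" "m > 0" "0 \<le> \<theta>"
  shows "(\<Sum>u\<in>W. exp (\<theta> * card {w \<in> W - {u}. P w})) / m
    \<le> exp (\<theta>\<^sup>2) * exp (\<theta> * (real (m - 1) / m) * card {w \<in> W. P w})"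
proof -
  define Y where "Y = card {w \<in> W. P w}"
  have Ym: "Y \<le> m"
    using assms by (auto simp: Y_def intro!: card_mono)
  have del: "exp (\<theta> * card {w \<in> W - {u}. P w}) = exp (\<theta> * Y) * (if P u then exp (- \<theta>) else 1)"
    if "u \<in> W" for u
  proof (cases "P u")
    case True
    have "{w \<in> W - {u}. P w} = {w \<in> W. P w} - {u}" by auto
    then have "card {w \<in> W - {u}. P w} = Y - 1"
      using that True assms(1) by (simp add: Y_def)
    moreover have "Y \<ge> 1"
      using that True assms(1) by (auto simp: Y_def Suc_le_eq card_gt_0_iff)
    ultimately show ?thesis
      using True by (simp add: exp_add[symmetric] algebra_simps of_nat_diff)
  next
    case False
    then have "{w \<in> W - {u}. P w} = {w \<in> W. P w}" by auto
    then show ?thesis using False by (simp add: Y_def)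
  qed
  have "(\<Sum>u\<in>W. if P u then exp (- \<theta>) else 1) = Y * exp (- \<theta>) + card {w \<in> W. \<not> P w}"
    using assms(1) by (simp add: sum.If_cases Y_def Int_def Compl_eq)
  moreover have "card {w \<in> W. \<not> P w} = m - Y"
  proof -
    have "{w \<in> W. \<not> P w} = W - {w \<in> W. P w}" by auto
    then show ?thesis
      using assms(1,2) by (simp add: Y_def card_Diff_subset)
  qed
  ultimately have "(\<Sum>u\<in>W. if P u then exp (- \<theta>) else 1) = Y * exp (- \<theta>) + (m - real Y)"
    using Ym by (simp add: of_nat_diff)
  also have "\<dots> = m * (1 - Y / m * (1 - exp (- \<theta>)))"
    using \<open>m > 0\<close> by (simp add: field_simps)
  finally have sum: "(\<Sum>u\<in>W. if P u then exp (- \<theta>) else 1) = m * (1 - Y / m * (1 - exp (- \<theta>)))" .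
  have "(\<Sum>u\<in>W. exp (\<theta> * card {w \<in> W - {u}. P w})) / m
      = exp (\<theta> * Y) * (\<Sum>u\<in>W. if P u then exp (- \<theta>) else 1) / m"
    using del by (simp add: sum_distrib_left)
  also have "\<dots> = exp (\<theta> * Y) * (1 - Y / m * (1 - exp (- \<theta>)))"
    using \<open>m > 0\<close> by (simp add: sum)
  \<comment> \<open>The quadratic bound on \<open>exp (- \<theta>)\<close> costs at most
    \<open>Y / m * \<theta>\<^sup>2\<close>, hence at most \<open>\<theta>\<^sup>2\<close>, in the
    exponent.\<close>
  also have "\<dots> \<le> exp (\<theta> * Y) * exp (\<theta>\<^sup>2 - Y / m * \<theta>)"
  proof (rule mult_left_mono)
    have "\<theta> - \<theta>\<^sup>2 \<le> 1 - exp (- \<theta>)"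
      using exp_minus_le_quadratic[OF assms(4)] by simp
    then have "Y / m * (\<theta> - \<theta>\<^sup>2) \<le> Y / m * (1 - exp (- \<theta>))"
      by (rule mult_left_mono) simp
    moreover have "Y / m * \<theta>\<^sup>2 \<le> 1 * \<theta>\<^sup>2"
      using Ym \<open>m > 0\<close> by (intro mult_right_mono) auto
    ultimately have "1 - Y / m * (1 - exp (- \<theta>)) \<le> 1 + (\<theta>\<^sup>2 - Y / m * \<theta>)"
      unfolding right_diff_distrib by linarith
    also have "\<dots> \<le> exp (\<theta>\<^sup>2 - Y / m * \<theta>)" by (rule exp_ge_add_one_self)
    finally show "1 - Y / m * (1 - exp (- \<theta>)) \<le> exp (\<theta>\<^sup>2 - Y / m * \<theta>)" .
  qed simp
  \<comment> \<open>\<open>Y - Y / m\<close> is the expected number of points of \<open>P\<close>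
    left after the deletion.\<close>
  also have "\<dots> = exp (\<theta>\<^sup>2) * exp (\<theta> * (real (m - 1) / m) * Y)"
    using \<open>m > 0\<close> by (simp add: exp_add[symmetric] field_simps of_nat_diff)
  finally show ?thesis by (simp add: Y_def)
qed

text \<open>The potential after the deletion is a sum over classes in which the summand of class
  \<open>j\<close> depends only on \<open>K j\<close>. It is thus a vertex weighting to which the
  light clique lemma applies, and averaging the summands gives the exponential moments just
  bounded.\<close>

lemma clique_keeping_potential:
  fixes W U :: "nat \<Rightarrow> 'a set" and \<theta> :: real
  assumes fin: "\<And>j. j < q \<Longrightarrow> finite (W j)" and cardW: "\<And>j. j < q \<Longrightarrow> card (W j) = m"
    and "m > 0" "q > 0"
    and sym: "\<And>u v. adj u v \<Longrightarrow> adj v u"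
    and nonadj: "\<And>i j v. i < q \<Longrightarrow> j < q \<Longrightarrow> i \<noteq> j \<Longrightarrow> v \<in> W i \<Longrightarrow> q * card {u \<in> W j. \<not> adj v u} \<le> m"
    and \<theta>: "0 \<le> \<theta>"
  shows "\<exists>K. clique_on q adj K \<and> (\<forall>j<q. K j \<in> W j) \<and>
    (\<Sum>j<q. \<Sum>v\<in>U j. exp (\<theta> * card {u \<in> W j - {K j}. \<not> adj v u}))
    \<le> exp (\<theta>\<^sup>2) * (\<Sum>j<q. \<Sum>v\<in>U j. exp (\<theta> * (real (m - 1) / m) * card {u \<in> W j. \<not> adj v u}))"
proof -
  define f where "f j w = (\<Sum>v\<in>U j. exp (\<theta> * card {u \<in> W j - {w}. \<not> adj v u}))" for j w
  obtain K where K: "clique_on q adj K" "\<forall>j<q. K j \<in> W j"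
    "(\<Sum>j<q. f j (K j)) \<le> (\<Sum>j<q. (\<Sum>u\<in>W j. f j u) / m)"
    using clique_weight_le_average[of q W m adj f] fin cardW \<open>m > 0\<close> \<open>q > 0\<close> sym nonadj
    by blast
  note K(3)
  also have "(\<Sum>j<q. (\<Sum>u\<in>W j. f j u) / m)
    \<le> (\<Sum>j<q. \<Sum>v\<in>U j. exp (\<theta>\<^sup>2) * exp (\<theta> * (real (m - 1) / m) * card {u \<in> W j. \<not> adj v u}))"
  proof (intro sum_mono)
    fix j assume j: "j \<in> {..<q}"
    have "(\<Sum>u\<in>W j. f j u) / m = (\<Sum>v\<in>U j. (\<Sum>w\<in>W j. exp (\<theta> * card {u \<in> W j - {w}. \<not> adj v u})) / m)"
      unfolding f_def by (subst sum.swap) (simp add: sum_divide_distrib)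
    also have "\<dots> \<le> (\<Sum>v\<in>U j. exp (\<theta>\<^sup>2) * exp (\<theta> * (real (m - 1) / m) * card {u \<in> W j. \<not> adj v u}))"
      using j by (intro sum_mono sum_exp_card_delete_le fin cardW \<theta> \<open>m > 0\<close>) auto
    finally show "(\<Sum>u\<in>W j. f j u) / m \<le> \<dots>" .
  qed
  finally show ?thesis
    using K(1,2) by (auto simp: f_def sum_distrib_left)
qed

text \<open>The invariant is that \<open>\<Phi>\<close> stays below \<open>B t\<close> after
  \<open>t\<close> removals. A single summand of \<open>\<Phi>\<close> then shows that every
  remaining vertex misses at most a \<open>1 / q\<close> share of each other class, which is what
  the choice of the next clique requires.\<close>

lemma almost_tiling:
  fixes \<kappa> \<gamma> :: real
  assumes "q > 0" "0 \<le> \<kappa>" "\<kappa> < 1 / q" "0 < \<gamma>" "\<gamma> \<le> 1"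
  shows "\<forall>\<^sub>F N in sequentially. \<forall>(W :: nat \<Rightarrow> 'a set) adj.
    dense_multipartite q adj W N \<kappa> \<longrightarrow>
    (\<exists>R. (\<forall>j<q. R j \<subseteq> W j \<and> card (R j) = nat \<lceil>\<gamma> * N\<rceil>) \<and> tileable q adj (\<lambda>j. W j - R j))"
proof -
  \<comment> \<open>\<open>\<sigma>\<close> is the slack in the degree condition. The scale
    \<open>\<eta>\<close> makes the bound \<open>(\<eta> / \<gamma>)\<^sup>2\<close> on the growth
    exponent per step equal to \<open>c\<close>; and \<open>2 * c = \<eta> * \<sigma>\<close> lets a
    prefactor \<open>exp (c * N)\<close> and \<open>N\<close> steps of growth use up the slack
    exactly.\<close>
  define \<sigma> where "\<sigma> = 1 / q - \<kappa>"
  define \<eta> where "\<eta> = \<gamma>\<^sup>2 * \<sigma> / 2"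
  define c where "c = \<eta> * \<sigma> / 2"
  have \<sigma>: "0 < \<sigma>"
    using assms by (simp add: \<sigma>_def)
  have \<eta>: "\<eta> > 0" using \<sigma> assms by (simp add: \<eta>_def)
  have c: "c > 0" using \<sigma> \<eta> by (simp add: c_def)
  have \<eta>\<gamma>: "(\<eta> / \<gamma>)\<^sup>2 = c"
    using assms by (simp add: c_def \<eta>_def power2_eq_square field_simps)
  \<comment> \<open>Large enough that the number of summands of \<open>\<Phi>\<close>, at most
    \<open>q * (q * N)\<close>, is below \<open>exp (c * N)\<close>, by
    \<open>exp x \<ge> x\<^sup>2 / 2\<close>.\<close>
  define N0 where "N0 = nat \<lceil>2 * q\<^sup>2 / c\<^sup>2\<rceil> + 1"
  show ?thesis
  proof (rule eventually_sequentiallyI[of N0], intro allI impI)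
    fix N and W :: "nat \<Rightarrow> 'a set" and adj
    assume N: "N \<ge> N0" and "dense_multipartite q adj W N \<kappa>"
    then have W: "\<forall>j<q. finite (W j) \<and> card (W j) = N"
      and sym: "\<forall>u v. adj u v \<longrightarrow> adj v u"
      and nonadj: "\<forall>i<q. \<forall>j<q. i \<noteq> j \<longrightarrow> (\<forall>v\<in>W i. card {u \<in> W j. \<not> adj v u} \<le> \<kappa> * N)"
      by (auto simp: dense_multipartite_def)
    define r where "r = nat \<lceil>\<gamma> * N\<rceil>"
    have N1: "N > 0" "2 * q\<^sup>2 / c\<^sup>2 \<le> N"
    proof -
      show "N > 0" using N by (simp add: N0_def)
      have "2 * q\<^sup>2 / c\<^sup>2 \<le> real N0" unfolding N0_def by linarith
      also have "\<dots> \<le> N" using N by simp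
      finally show "2 * q\<^sup>2 / c\<^sup>2 \<le> N" .
    qed
    have Nexp: "q * (q * N) \<le> exp (c * N)"
    proof -
      have "2 * q\<^sup>2 \<le> N * c\<^sup>2"
        using N1 c by (simp add: field_simps)
      then have "real (2 * q\<^sup>2) * N \<le> N * c\<^sup>2 * N"
        by (rule mult_right_mono) simp
      then have "real (q * (q * N)) \<le> (c * N)\<^sup>2 / 2"
        by (simp add: power2_eq_square algebra_simps)
      also have "\<dots> \<le> exp (c * N)"
      proof -
        have "0 \<le> c * N" using c by simp
        then show ?thesis using exp_lower_Taylor_quadratic[of "c * N"] by linarith
      qed
      finally show ?thesis .
    qed
    have r: "\<gamma> * N \<le> r" "r > 0" "r \<le> N"
    proof -
      show "\<gamma> * N \<le> r" unfolding r_def by linarith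
      have "\<gamma> * N > 0" using assms N1 by simp
      then show "r > 0" unfolding r_def by linarith
      have "\<gamma> * N \<le> 1 * real N" using assms by (intro mult_right_mono) auto
      then show "r \<le> N" unfolding r_def by linarith
    qed
    \<comment> \<open>Removed vertices stay in \<open>U j\<close>, so the summation range of
      \<open>\<Phi>\<close> is the same at all times.\<close>
    define U where "U j = (\<Union>i\<in>{..<q}-{j}. W i)" for j
    have cardU: "card (U j) \<le> q * N" for j
    proof -
      have "card (U j) \<le> (\<Sum>i\<in>{..<q}-{j}. card (W i))"
        unfolding U_def by (rule card_UN_le) simp
      also have "\<dots> = card ({..<q} - {j}) * N"
        using W by simp
      also have "\<dots> \<le> q * N"
        using card_mono[of "{..<q}" "{..<q} - {j}"] by (intro mult_right_mono) auto
      finally show ?thesis .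
    qed
    \<comment> \<open>With \<open>m\<close> vertices left per class, the exponent is
      \<open>\<eta> * N\<close> times the proportion missed by \<open>v\<close>.\<close>
    define \<Phi> where "\<Phi> X m = (\<Sum>j<q. \<Sum>v\<in>U j. exp (\<eta> * N / m * card {u \<in> X j. \<not> adj v u}))"
      for X and m :: nat
    define B where "B t = q * (q * N) * exp (\<eta> * \<kappa> * N + t * c)" for t :: nat
    have B_le: "B t \<le> exp (\<eta> * N / q)" if "t \<le> N" for t
    proof -
      have "B t \<le> exp (c * N) * exp (\<eta> * \<kappa> * N + t * c)"
        unfolding B_def using Nexp by (intro mult_right_mono) auto
      also have "\<dots> \<le> exp (c * N) * exp (\<eta> * \<kappa> * N + N * c)"
        using that c by simp
      also have "\<dots> = exp (\<eta> * N / q)"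
        by (simp add: exp_add[symmetric] c_def \<sigma>_def algebra_simps)
      finally show ?thesis .
    qed
    have "\<exists>X. (\<forall>j<q. X j \<subseteq> W j \<and> card (X j) = N - t) \<and> tileable q adj (\<lambda>j. W j - X j) \<and>
        \<Phi> X (N - t) \<le> B t" if "t \<le> N - r" for t
      using that
    proof (induction t)
      case 0
      have "\<Phi> W N \<le> (\<Sum>j<q. \<Sum>v\<in>U j. exp (\<eta> * \<kappa> * N))"
        unfolding \<Phi>_def
      proof (intro sum_mono)
        fix j v assume "j \<in> {..<q}" "v \<in> U j"
        then have "card {u \<in> W j. \<not> adj v u} \<le> \<kappa> * N"
          using nonadj by (auto simp: U_def)
        then have "\<eta> * card {u \<in> W j. \<not> adj v u} \<le> \<eta> * (\<kappa> * N)"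
          using \<eta> by (intro mult_left_mono) auto
        then show "exp (\<eta> * N / N * card {u \<in> W j. \<not> adj v u}) \<le> exp (\<eta> * \<kappa> * N)"
          using N1 by simp
      qed
      also have "\<dots> = (\<Sum>j<q. card (U j) * exp (\<eta> * \<kappa> * N))"
        by simp
      also have "\<dots> \<le> (\<Sum>j<q. real (q * N) * exp (\<eta> * \<kappa> * N))"
        using cardU by (intro sum_mono mult_right_mono) (auto simp del: of_nat_mult)
      also have "\<dots> = B 0"
        by (simp add: B_def)
      finally show ?case
        using W by (intro exI[of _ W]) (auto intro: tileable.empty)
    next
      case (Suc t)
      then obtain X where X: "\<And>j. j < q \<Longrightarrow> X j \<subseteq> W j" "\<And>j. j < q \<Longrightarrow> card (X j) = N - t"
        "tileable q adj (\<lambda>j. W j - X j)" "\<Phi> X (N - t) \<le> B t"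
        by auto
      define m where "m = N - t"
      have m: "m > 0" "r \<le> m - 1" "m - 1 > 0"
        using Suc.prems r by (auto simp: m_def)
      \<comment> \<open>The scale of the potential after the deletion, when \<open>m - 1\<close>
        vertices are left; the factor \<open>(m - 1) / m\<close> from the moment bound turns it back
        into the scale of \<open>\<Phi> X m\<close>.\<close>
      define \<theta> where "\<theta> = \<eta> * N / real (m - 1)"
      have finX: "finite (X j)" if "j < q" for j
        using X(1) W that by (meson finite_subset)
      have \<theta>: "0 \<le> \<theta>" "\<theta> \<le> \<eta> / \<gamma>"
      proof -
        show "0 \<le> \<theta>" using \<eta> by (simp add: \<theta>_def)
        have "\<gamma> * N \<le> real (m - 1)" using r m by linarith
        then have "\<eta> * (\<gamma> * N) \<le> \<eta> * real (m - 1)"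
          using \<eta> by (intro mult_left_mono) auto
        then show "\<theta> \<le> \<eta> / \<gamma>"
          using m assms by (simp add: \<theta>_def field_simps)
      qed
      have \<theta>m: "\<theta> * (real (m - 1) / m) = \<eta> * N / m"
        using m by (simp add: \<theta>_def)
      \<comment> \<open>Were the proportion missed by \<open>v\<close> larger than
        \<open>1 / q\<close>, its summand alone would exceed \<open>exp (\<eta> * N / q)\<close>,
        the bound on the whole potential.\<close>
      have nonadjX: "q * card {u \<in> X j. \<not> adj v u} \<le> m"
        if ij: "i < q" "j < q" "i \<noteq> j" and v: "v \<in> X i" for i j v
      proof -
        have vU: "v \<in> U j"
          using ij v X(1) by (auto simp: U_def)
        have finU: "finite (U j)"
          using W by (auto simp: U_def)
        have "exp (\<eta> * N / m * card {u \<in> X j. \<not> adj v u})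
            \<le> (\<Sum>v\<in>U j. exp (\<eta> * N / m * card {u \<in> X j. \<not> adj v u}))"
          using vU finU by (intro member_le_sum) auto
        also have "\<dots> \<le> \<Phi> X m"
          unfolding \<Phi>_def using ij by (intro member_le_sum[of j]) (auto intro: sum_nonneg)
        also have "\<dots> \<le> exp (\<eta> * N / q)"
          using order_trans[OF X(4) B_le] Suc.prems by (simp add: m_def)
        finally have "\<eta> * N * (card {u \<in> X j. \<not> adj v u} / m) \<le> \<eta> * N * (1 / q)"
          by simp
        then have "card {u \<in> X j. \<not> adj v u} / m \<le> 1 / q"
          using \<eta> N1 by (subst (asm) mult_le_cancel_left_pos) auto
        then have "real (q * card {u \<in> X j. \<not> adj v u}) \<le> real m"
          using m \<open>q > 0\<close> by (simp add: field_simps)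
        then show ?thesis by linarith
      qed
      obtain K where K: "clique_on q adj K" "\<forall>j<q. K j \<in> X j"
        "(\<Sum>j<q. \<Sum>v\<in>U j. exp (\<theta> * card {u \<in> X j - {K j}. \<not> adj v u}))
          \<le> exp (\<theta>\<^sup>2) * (\<Sum>j<q. \<Sum>v\<in>U j. exp (\<theta> * (real (m - 1) / m) * card {u \<in> X j. \<not> adj v u}))"
        using clique_keeping_potential[of q X m adj \<theta> U] finX X(2) m(1) \<open>q > 0\<close> sym nonadjX \<theta>(1)
        by (auto simp: m_def)
      define X' where "X' j = X j - {K j}" for j
      have "\<Phi> X' (m - 1) \<le> exp (\<theta>\<^sup>2) * \<Phi> X m"
        using K(3) unfolding \<theta>m by (simp add: \<Phi>_def X'_def \<theta>_def)
      also have "\<dots> \<le> exp c * B t"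
      proof (intro mult_mono)
        have "\<theta>\<^sup>2 \<le> (\<eta> / \<gamma>)\<^sup>2"
          using \<theta> by (intro power_mono) auto
        then show "exp (\<theta>\<^sup>2) \<le> exp c" using \<eta>\<gamma> by simp
        show "\<Phi> X m \<le> B t" using X(4) by (simp add: m_def)
        show "0 \<le> \<Phi> X m" unfolding \<Phi>_def by (intro sum_nonneg) auto
      qed simp
      also have "\<dots> = B (Suc t)"
        by (simp add: B_def exp_add algebra_simps)
      finally have "\<Phi> X' (N - Suc t) \<le> B (Suc t)"
        by (simp add: m_def)
      moreover have "tileable q adj (\<lambda>j. W j - X' j)"
        using X(3) K(1)
      proof (rule tileable.insert)
        fix j assume j: "j < q"
        then have "K j \<in> X j" "K j \<in> W j" using K(2) X(1) by auto
        then show "K j \<notin> W j - X j" "W j - X' j = insert (K j) (W j - X j)"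
          using X(1)[OF j] by (auto simp: X'_def)
      qed
      moreover have "X' j \<subseteq> W j \<and> card (X' j) = N - Suc t" if "j < q" for j
        using that K(2) X(1,2) finX by (auto simp: X'_def)
      ultimately show ?case by blast
    qed
    from this[of "N - r"] obtain X where "\<forall>j<q. X j \<subseteq> W j \<and> card (X j) = N - (N - r)"
      "tileable q adj (\<lambda>j. W j - X j)" by blast
    then show "\<exists>R. (\<forall>j<q. R j \<subseteq> W j \<and> card (R j) = nat \<lceil>\<gamma> * N\<rceil>) \<and> tileable q adj (\<lambda>j. W j - R j)"
      using r(3) by (intro exI[of _ X]) (simp add: r_def[symmetric])
  qed
qed

section \<open>Absorbers\<close>

lemma tileable_cong:
  assumes "tileable q adj W" and eq: "\<And>i. i < q \<Longrightarrow> X i = W i"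
  shows "tileable q adj X"
  using assms(1)
proof cases
  case empty
  then show ?thesis by (intro tileable.empty) (simp add: eq)
next
  case (insert W' K)
  show ?thesis
    using insert(1,2) by (rule tileable.insert) (simp_all add: eq insert(3,4))
qed

lemma tileable_Un:
  assumes "tileable q adj W" "tileable q adj W'" "\<And>i. i < q \<Longrightarrow> W i \<inter> W' i = {}"
    "\<And>i. i < q \<Longrightarrow> X i = W i \<union> W' i"
  shows "tileable q adj X"
  using assms
proof (induction arbitrary: X rule: tileable.induct)
  case (empty W)
  show ?case
    using empty.prems(1) by (rule tileable_cong) (use empty.hyps empty.prems(3) in simp)
next
  case (insert W1 K W)
  have "tileable q adj (\<lambda>i. W1 i \<union> W' i)"
  proof (rule insert.IH[OF insert.prems(1)])
    show "W1 i \<inter> W' i = {}" if "i < q" for i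
      using insert.prems(2)[OF that] insert.hyps(4)[OF that] by blast
  qed simp
  then show ?case
    using insert.hyps(2)
  proof (rule tileable.insert)
    fix i assume "i < q"
    then show "K i \<notin> W1 i \<union> W' i" "X i = insert (K i) (W1 i \<union> W' i)"
      using insert.prems(2,3)[of i] insert.hyps(3,4)[of i] by auto
  qed
qed

lemma tileable_UN:
  assumes "finite T" "\<And>t. t \<in> T \<Longrightarrow> tileable q adj (W t)"
    "\<And>s t i. s \<in> T \<Longrightarrow> t \<in> T \<Longrightarrow> s \<noteq> t \<Longrightarrow> i < q \<Longrightarrow> W s i \<inter> W t i = {}"
  shows "tileable q adj (\<lambda>i. \<Union>t\<in>T. W t i)"
  using assms
proof (induction T rule: finite_induct)
  case empty
  then show ?case by (auto intro: tileable.empty)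
next
  case (insert t T)
  show ?case
  proof (rule tileable_Un[of q adj "W t" "\<lambda>i. \<Union>t\<in>T. W t i"])
    show "tileable q adj (W t)" using insert.prems by simp
    show "tileable q adj (\<lambda>i. \<Union>t\<in>T. W t i)"
      using insert.prems by (intro insert.IH) auto
    show "W t i \<inter> (\<Union>t\<in>T. W t i) = {}" if "i < q" for i
      using insert.prems(2)[of t _ i] insert.hyps(2) that by fastforce
  qed auto
qed

lemma tileable_rows:
  assumes "finite T" "\<And>t. t \<in> T \<Longrightarrow> clique_on q adj (K t)" "\<And>i. i < q \<Longrightarrow> inj_on (\<lambda>t. K t i) T"
  shows "tileable q adj (\<lambda>i. (\<lambda>t. K t i) ` T)"
proof -
  have "tileable q adj (\<lambda>i. \<Union>t\<in>T. {K t i})"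
  proof (rule tileable_UN)
    show "tileable q adj (\<lambda>i. {K t i})" if "t \<in> T" for t
      by (rule tileable.insert[of q adj "\<lambda>_. {}" "K t"]) (use assms(2) that in \<open>auto intro: tileable.empty\<close>)
    show "{K s i} \<inter> {K t i} = {}" if "s \<in> T" "t \<in> T" "s \<noteq> t" "i < q" for s t i
      using assms(3)[of i] that by (auto dest: inj_onD)
  qed (use assms in auto)
  moreover have "(\<Union>t\<in>T. {K t i}) = (\<lambda>t. K t i) ` T" for i by auto
  ultimately show ?thesis by simp
qed

section \<open>Absorbing matrices and the greedy choice of many disjoint ones\<close>

text \<open>The entry \<open>S (i, j)\<close> stands in row \<open>i\<close> and is meant to lie in
  class \<open>j\<close>, so a column is what the matrix uses of one class.\<close>

definition col_set :: "nat \<Rightarrow> (nat \<times> nat \<Rightarrow> 'a) \<Rightarrow> nat \<Rightarrow> 'a set" where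
  "col_set q S j = (\<lambda>i. S (i, j)) ` {..<q}"

text \<open>The entries of \<open>S\<close> are tiled by the rows. Moving \<open>x i\<close> to the diagonal position of row \<open>i\<close>
  frees the diagonal, which is one further clique.\<close>
definition absorbs :: "nat \<Rightarrow> ('a \<Rightarrow> 'a \<Rightarrow> bool) \<Rightarrow> (nat \<times> nat \<Rightarrow> 'a) \<Rightarrow> (nat \<Rightarrow> 'a) \<Rightarrow> bool" where
  "absorbs q adj S x \<longleftrightarrow>
     (\<forall>i<q. clique_on q adj (\<lambda>j. S (i, j))) \<and> clique_on q adj (\<lambda>j. S (j, j)) \<and>
     (\<forall>i<q. clique_on q adj ((\<lambda>j. S (i, j))(i := x i))) \<and>
     (\<forall>j<q. inj_on (\<lambda>i. S (i, j)) {..<q} \<and> x j \<notin> col_set q S j)"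

text \<open>Allows the transversals to be drawn from a finite set of extensional functions.\<close>

lemma absorbs_restrict: "absorbs q adj S (restrict x {..<q}) = absorbs q adj S x"
  by (simp add: absorbs_def)

lemma absorbs_imp_tileable_col_set:
  assumes "absorbs q adj S x"
  shows "tileable q adj (col_set q S)"
proof -
  have "tileable q adj (\<lambda>j. (\<lambda>i. S (i, j)) ` {..<q})"
    using assms by (intro tileable_rows[where K = "\<lambda>i j. S (i, j)"]) (auto simp: absorbs_def)
  then show ?thesis by (simp add: col_set_def[abs_def])
qed

lemma absorbs_imp_tileable_insert:
  assumes "absorbs q adj S x"
  shows "tileable q adj (\<lambda>j. insert (x j) (col_set q S j))"
proof -
  \<comment> \<open>Index \<open>q\<close> holds the diagonal clique, which becomes available once
    each \<open>x t\<close> has taken the place of \<open>S (t, t)\<close> in row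
    \<open>t\<close>.\<close>
  define K where "K t = (if t < q then (\<lambda>j. S (t, j))(t := x t) else (\<lambda>j. S (j, j)))" for t
  have inj: "inj_on (\<lambda>i. S (i, j)) {..<q}" and new: "x j \<notin> (\<lambda>i. S (i, j)) ` {..<q}" if "j < q" for j
    using assms that by (simp_all add: absorbs_def col_set_def)
  have new': "S (i, j) \<noteq> x j" if "i < q" "j < q" for i j
  proof
    assume "S (i, j) = x j"
    then have "x j \<in> (\<lambda>i. S (i, j)) ` {..<q}" using that(1) by force
    with new[OF that(2)] show False by blast
  qed
  have K: "K t j = (if t < q then if t = j then x j else S (t, j) else S (j, j))" for t j
    by (simp add: K_def)
  have "tileable q adj (\<lambda>j. (\<lambda>t. K t j) ` {..q})"
  proof (rule tileable_rows)
    show "clique_on q adj (K t)" if "t \<in> {..q}" for t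
      using assms by (auto simp: K_def absorbs_def)
    show "inj_on (\<lambda>t. K t j) {..q}" if j: "j < q" for j
    proof (rule inj_onI)
      fix s t assume "s \<in> {..q}" "t \<in> {..q}" "K s j = K t j"
      then show "s = t"
        using inj_onD[OF inj[OF j], of s t] inj_onD[OF inj[OF j], of s j] inj_onD[OF inj[OF j], of j t]
          new'[OF _ j, of s] new'[OF _ j, of t] new'[OF _ j, of j] j
        by (auto simp: K split: if_splits)
    qed
  qed simp
  then have "tileable q adj (\<lambda>j. if j < q then insert (x j) (col_set q S j) else {})"
  proof (rule tileable_cong)
    fix j assume j: "j < q"
    have "(\<lambda>t. K t j) ` {..q} = insert (x j) (col_set q S j)"
    proof (intro equalityI subsetI)
      fix y assume "y \<in> (\<lambda>t. K t j) ` {..q}"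
      then show "y \<in> insert (x j) (col_set q S j)"
        using j by (auto simp: K col_set_def)
    next
      fix y assume "y \<in> insert (x j) (col_set q S j)"
      then consider "y = x j" | i where "i < q" "y = S (i, j)"
        by (auto simp: col_set_def)
      \<comment> \<open>\<open>x j\<close> lies in clique \<open>j\<close>, the diagonal entry
        \<open>S (j, j)\<close> in clique \<open>q\<close>, and any other \<open>S (i, j)\<close> in
        clique \<open>i\<close>.\<close>
      then have "\<exists>t\<le>q. y = K t j"
      proof cases
        case 1
        then show ?thesis using j by (intro exI[of _ j]) (simp add: K)
      next
        case 2
        then show ?thesis
          by (intro exI[of _ "if i = j then q else i"]) (simp add: K)
      qed
      then show "y \<in> (\<lambda>t. K t j) ` {..q}" by auto
    qed
    then show "(if j < q then insert (x j) (col_set q S j) else {}) = (\<lambda>t. K t j) ` {..q}"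
      using j by simp
  qed
  then show ?thesis
    by (rule tileable_cong) simp
qed

text \<open>Induct on \<open>r\<close>: take one leftover vertex from each class as \<open>x\<close>
  and spend one matrix absorbing \<open>x\<close>. Dropping that matrix lowers every count of
  absorbers by at most one, and the number of leftover vertices per class drops by one as
  well.\<close>

lemma tileable_absorb_leftover:
  assumes "finite F"
    and "\<And>S. S \<in> F \<Longrightarrow> tileable q adj (col_set q S)"
    and "\<And>S S' j. S \<in> F \<Longrightarrow> S' \<in> F \<Longrightarrow> S \<noteq> S' \<Longrightarrow> j < q \<Longrightarrow> col_set q S j \<inter> col_set q S' j = {}"
    and "\<And>j. j < q \<Longrightarrow> L j \<subseteq> V j \<and> finite (L j) \<and> card (L j) = r"
    and "\<And>S j. S \<in> F \<Longrightarrow> j < q \<Longrightarrow> L j \<inter> col_set q S j = {}"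
    and "\<And>x. (\<And>j. j < q \<Longrightarrow> x j \<in> V j) \<Longrightarrow> r \<le> card {S \<in> F. absorbs q adj S x}"
  shows "tileable q adj (\<lambda>j. L j \<union> (\<Union>S\<in>F. col_set q S j))"
  using assms
proof (induction r arbitrary: F L)
  case 0
  have "tileable q adj (\<lambda>j. \<Union>S\<in>F. col_set q S j)"
    using 0 by (intro tileable_UN) auto
  then show ?case
  proof (rule tileable_cong)
    fix j assume "j < q"
    then have "L j = {}" using "0.prems"(4)[of j] by (metis card_0_eq)
    then show "L j \<union> (\<Union>S\<in>F. col_set q S j) = (\<Union>S\<in>F. col_set q S j)" by simp
  qed
next
  case (Suc r)
  have "\<exists>v. v \<in> L j" if "j < q" for j
    using Suc.prems(4)[OF that] by (metis card.empty ex_in_conv nat.distinct(1))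
  then obtain x where x: "\<And>j. j < q \<Longrightarrow> x j \<in> L j"
    by metis
  then have "Suc r \<le> card {S \<in> F. absorbs q adj S x}"
    using Suc.prems(4) by (intro Suc.prems(6)) blast
  then have "{S \<in> F. absorbs q adj S x} \<noteq> {}"
    by (metis card.empty not_less_eq_eq zero_le)
  then obtain S where S: "S \<in> F" "absorbs q adj S x" by blast
  define L' where "L' j = L j - {x j}" for j
  define F' where "F' = F - {S}"
  have "tileable q adj (\<lambda>j. L' j \<union> (\<Union>S\<in>F'. col_set q S j))"
  proof (rule Suc.IH)
    show "L' j \<subseteq> V j \<and> finite (L' j) \<and> card (L' j) = r" if "j < q" for j
      using Suc.prems(4)[OF that] x[OF that] by (auto simp: L'_def)
    show "r \<le> card {S \<in> F'. absorbs q adj S y}" if "\<And>j. j < q \<Longrightarrow> y j \<in> V j" for y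
    proof -
      have "Suc r \<le> card {S \<in> F. absorbs q adj S y}"
        using Suc.prems(6) that by blast
      also have "\<dots> \<le> card (insert S {S \<in> F'. absorbs q adj S y})"
        using Suc.prems(1) by (intro card_mono) (auto simp: F'_def)
      also have "\<dots> \<le> Suc (card {S \<in> F'. absorbs q adj S y})"
        by (rule card_insert_le_m1) simp_all
      finally show ?thesis by simp
    qed
    show "L' j \<inter> col_set q S' j = {}" if "S' \<in> F'" "j < q" for S' j
      using Suc.prems(5)[of S' j] that by (auto simp: L'_def F'_def)
  qed (use Suc.prems in \<open>auto simp: F'_def\<close>)
  then show ?case
  proof (rule tileable_Un[OF _ absorbs_imp_tileable_insert[OF S(2)]])
    fix j assume j: "j < q"
    have "L j \<inter> col_set q S' j = {}" if "S' \<in> F" for S'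
      using Suc.prems(5) that j by blast
    moreover have "col_set q S j \<inter> col_set q S' j = {}" if "S' \<in> F'" for S'
      using Suc.prems(3)[of S S' j] that S(1) j by (auto simp: F'_def)
    ultimately show "(L' j \<union> (\<Union>S\<in>F'. col_set q S j)) \<inter> insert (x j) (col_set q S j) = {}"
      using x[OF j] S(1) unfolding L'_def F'_def by blast
    show "L j \<union> (\<Union>S\<in>F. col_set q S j) = L' j \<union> (\<Union>S\<in>F'. col_set q S j) \<union> insert (x j) (col_set q S j)"
      using x[OF j] S(1) unfolding L'_def F'_def by blast
  qed
qed

text \<open>Each element of \<open>X\<close> carries the weight \<open>2\<^sup>-\<^sup>h\<close>, where \<open>h\<close> counts the members of the family
  hitting it so far; greedily adding a member of at least average hit weight shrinks the total
  weight by the factor \<open>1 - p/2\<close>.\<close>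
lemma compatible_family_hitting_often:
  fixes p :: real and \<S> :: "'a set" and X :: "'b set" and free_of :: "'a \<Rightarrow> 'a \<Rightarrow> bool"
  assumes fin: "finite \<S>" "finite X" and "X \<noteq> {}" "\<S> \<noteq> {}" "0 < p"
    and irrefl: "\<And>S. S \<in> \<S> \<Longrightarrow> \<not> free_of S S" and sym: "\<And>S S'. free_of S S' \<Longrightarrow> free_of S' S"
    and many: "\<And>F x. F \<subseteq> \<S> \<Longrightarrow> card F < M \<Longrightarrow> x \<in> X \<Longrightarrow>
      p * card \<S> \<le> card {S \<in> \<S>. hit S x \<and> (\<forall>S'\<in>F. free_of S S')}"
    and small: "card X * (1 - p / 2) ^ M \<le> (1 / 2) ^ r"
  shows "\<exists>F\<subseteq>\<S>. card F = M \<and> (\<forall>S\<in>F. \<forall>S'\<in>F. S \<noteq> S' \<longrightarrow> free_of S S') \<and>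
    (\<forall>x\<in>X. r \<le> card {S \<in> F. hit S x})"
proof -
  define w :: "'a set \<Rightarrow> 'b \<Rightarrow> real" where "w F x = (1 / 2) ^ card {S \<in> F. hit S x}" for F x
  have w_pos: "0 < w F x" for F x by (simp add: w_def)
  have "\<exists>F\<subseteq>\<S>. card F = s \<and> (\<forall>S\<in>F. \<forall>S'\<in>F. S \<noteq> S' \<longrightarrow> free_of S S') \<and>
      (\<Sum>x\<in>X. w F x) \<le> card X * (1 - p / 2) ^ s" if "s \<le> M" for s
    using that
  proof (induction s)
    case 0
    show ?case by (intro exI[of _ "{}"]) (simp add: w_def)
  next
    case (Suc s)
    then obtain F where F: "F \<subseteq> \<S>" "card F = s" "\<forall>S\<in>F. \<forall>S'\<in>F. S \<noteq> S' \<longrightarrow> free_of S S'"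
      "(\<Sum>x\<in>X. w F x) \<le> card X * (1 - p / 2) ^ s"
      by auto
    define C where "C = {S \<in> \<S>. \<forall>S'\<in>F. free_of S S'}"
    have finC: "finite C" and CS: "C \<subseteq> \<S>" using fin by (auto simp: C_def)
    have manyC: "p * card \<S> \<le> card {S \<in> C. hit S x}" if "x \<in> X" for x
    proof -
      have "{S \<in> C. hit S x} = {S \<in> \<S>. hit S x \<and> (\<forall>S'\<in>F. free_of S S')}"
        by (auto simp: C_def)
      then show ?thesis using many[OF F(1) _ that] F(2) Suc.prems by simp
    qed
    have "C \<noteq> {}"
    proof
      assume "C = {}"
      with manyC \<open>X \<noteq> {}\<close> have "p * card \<S> \<le> 0" by auto
      moreover have "p * card \<S> > 0" using fin \<open>\<S> \<noteq> {}\<close> \<open>0 < p\<close> by (simp add: card_gt_0_iff)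
      ultimately show False by simp
    qed
    define t where "t S = (\<Sum>x\<in>X. if hit S x then w F x else 0)" for S
    \<comment> \<open>Double counting: each \<open>x\<close> is hit by at least
      \<open>p * card \<S>\<close> of the compatible members, and there are at most
      \<open>card \<S>\<close> of these, so some \<open>S\<close> has hit weight at least
      \<open>p\<close> times the total weight.\<close>
    have "(\<Sum>S\<in>C. p * (\<Sum>x\<in>X. w F x)) = card C * (p * (\<Sum>x\<in>X. w F x))"
      by simp
    also have "\<dots> \<le> card \<S> * (p * (\<Sum>x\<in>X. w F x))"
      using CS fin \<open>0 < p\<close> w_pos
      by (intro mult_right_mono mult_nonneg_nonneg sum_nonneg) (auto intro: card_mono less_imp_le)
    also have "\<dots> = (\<Sum>x\<in>X. w F x * (p * card \<S>))"
      by (simp add: sum_distrib_left sum_distrib_right mult_ac)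
    also have "\<dots> \<le> (\<Sum>x\<in>X. w F x * card {S \<in> C. hit S x})"
      using manyC w_pos by (intro sum_mono mult_left_mono) (auto intro: less_imp_le)
    also have "\<dots> = (\<Sum>x\<in>X. \<Sum>S\<in>C. if hit S x then w F x else 0)"
      using finC by (simp add: sum.If_cases Int_def mult.commute)
    also have "\<dots> = (\<Sum>S\<in>C. t S)"
      unfolding t_def by (rule sum.swap)
    finally obtain S where S: "S \<in> C" "p * (\<Sum>x\<in>X. w F x) \<le> t S"
      using sum_strict_mono[OF finC \<open>C \<noteq> {}\<close>, of t "\<lambda>_. p * (\<Sum>x\<in>X. w F x)"] by force
    have SF: "S \<notin> F" using irrefl S(1) by (auto simp: C_def)
    have finF: "finite F" using F(1) fin finite_subset by blast
    have w_insert: "w (insert S F) x = w F x - (if hit S x then w F x else 0) / 2" for x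
    proof (cases "hit S x")
      case True
      then have "{S' \<in> insert S F. hit S' x} = insert S {S' \<in> F. hit S' x}" by auto
      then show ?thesis using True SF finF by (simp add: w_def)
    next
      case False
      then have "{S' \<in> insert S F. hit S' x} = {S' \<in> F. hit S' x}" by auto
      then show ?thesis using False by (simp add: w_def)
    qed
    \<comment> \<open>Keeps the factor \<open>1 - p / 2\<close> nonnegative, so that the bound for
      \<open>s\<close> can be multiplied by it.\<close>
    have p2: "p \<le> 1"
    proof -
      obtain x where "x \<in> X" using \<open>X \<noteq> {}\<close> by blast
      then have "p * card \<S> \<le> card {S \<in> C. hit S x}" by (rule manyC)
      also have "\<dots> \<le> real (card \<S>)" using CS fin by (auto intro!: card_mono)
      finally show ?thesis using fin \<open>\<S> \<noteq> {}\<close> by (simp add: card_gt_0_iff)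
    qed
    have "(\<Sum>x\<in>X. w (insert S F) x) = (\<Sum>x\<in>X. w F x) - t S / 2"
      by (simp add: w_insert sum_subtractf t_def sum_divide_distrib)
    also have "\<dots> \<le> (1 - p / 2) * (\<Sum>x\<in>X. w F x)"
      using S(2) by (simp add: algebra_simps)
    also have "\<dots> \<le> (1 - p / 2) * (card X * (1 - p / 2) ^ s)"
      using F(4) p2 by (intro mult_left_mono) auto
    finally have "(\<Sum>x\<in>X. w (insert S F) x) \<le> card X * (1 - p / 2) ^ Suc s"
      by (simp add: mult_ac)
    moreover have "\<forall>S1\<in>insert S F. \<forall>S2\<in>insert S F. S1 \<noteq> S2 \<longrightarrow> free_of S1 S2"
      using F(3) S(1) sym by (auto simp: C_def)
    ultimately show ?case
      using F(1,2) S(1) CS SF finF by (intro exI[of _ "insert S F"]) auto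
  qed
  from this[of M] obtain F where F: "F \<subseteq> \<S>" "card F = M" "\<forall>S\<in>F. \<forall>S'\<in>F. S \<noteq> S' \<longrightarrow> free_of S S'"
      "(\<Sum>x\<in>X. w F x) \<le> card X * (1 - p / 2) ^ M"
    by auto
  \<comment> \<open>One weight alone is at most the total, and a weight of at most
    \<open>(1 / 2) ^ r\<close> means at least \<open>r\<close> hits.\<close>
  have "r \<le> card {S \<in> F. hit S x}" if "x \<in> X" for x
  proof -
    have "w F x \<le> (\<Sum>x\<in>X. w F x)"
      using that fin w_pos by (intro member_le_sum) (auto intro: less_imp_le)
    also have "\<dots> \<le> (1 / 2) ^ r" using F(4) small by simp
    finally have "(1 / 2 :: real) ^ card {S \<in> F. hit S x} \<le> (1 / 2) ^ r" by (simp add: w_def)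
    then show ?thesis
      by simp
  qed
  with F(1-3) show ?thesis by (intro exI[of _ F]) simp
qed

section \<open>Counting the absorbers of a transversal and choosing the absorbing family\<close>

text \<open>Fill the positions of \<open>D\<close> one by one, starting from the partial fillings in
  \<open>G P\<close>. Each partial filling has at least \<open>a\<close> extensions, and different
  pairs of a filling and a value give different results because fillings are extensional.\<close>

lemma card_ge_power_of_extensions:
  fixes a :: real
  assumes "finite D" "P \<inter> D = {}" "0 \<le> a"
    and fin: "\<And>Q. P \<subseteq> Q \<Longrightarrow> Q \<subseteq> P \<union> D \<Longrightarrow> finite (G Q)"
    and extn: "\<And>Q f. P \<subseteq> Q \<Longrightarrow> Q \<subseteq> P \<union> D \<Longrightarrow> f \<in> G Q \<Longrightarrow> f \<in> extensional Q"
    and step: "\<And>Q p f. P \<subseteq> Q \<Longrightarrow> Q \<subseteq> P \<union> D \<Longrightarrow> p \<in> D - Q \<Longrightarrow> f \<in> G Q \<Longrightarrow>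
      \<exists>A. finite A \<and> a \<le> card A \<and> (\<forall>v\<in>A. f(p := v) \<in> G (insert p Q))"
  shows "a ^ card D * card (G P) \<le> card (G (P \<union> D))"
proof -
  have "a ^ card E * card (G P) \<le> card (G (P \<union> E))" if "finite E" "E \<subseteq> D" for E
    using that
  proof (induction E rule: finite_induct)
    case empty
    then show ?case by simp
  next
    case (insert p E)
    define Q where "Q = P \<union> E"
    have Q: "P \<subseteq> Q" "Q \<subseteq> P \<union> D" "p \<in> D - Q" "insert p Q \<subseteq> P \<union> D"
      using insert.prems insert.hyps \<open>P \<inter> D = {}\<close> by (auto simp: Q_def)
    obtain A where A: "\<And>f. f \<in> G Q \<Longrightarrow> finite (A f)" "\<And>f. f \<in> G Q \<Longrightarrow> a \<le> card (A f)"
      "\<And>f v. f \<in> G Q \<Longrightarrow> v \<in> A f \<Longrightarrow> f(p := v) \<in> G (insert p Q)"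
      using step[OF Q(1,2,3)] by metis
    define h where "h = (\<lambda>(f, v). f(p := v :: 'b))"
    have "inj_on h (Sigma (G Q) A)"
    proof (rule inj_onI, clarsimp simp: h_def)
      fix f v f' v' assume f: "f \<in> G Q" "f' \<in> G Q" and eq: "f(p := v) = f'(p := v')"
      have "f y = f' y" for y
      proof (cases "y = p")
        case True
        then show ?thesis
          using extn[OF Q(1,2) f(1)] extn[OF Q(1,2) f(2)] Q(3) by (auto simp: extensional_def)
      next
        case False
        then show ?thesis using eq by (metis fun_upd_other)
      qed
      then have "f = f'" by (rule ext)
      moreover have "v = v'" using eq by (metis fun_upd_same)
      ultimately show "f = f' \<and> v = v'" by simp
    qed
    then have "card (Sigma (G Q) A) \<le> card (G (insert p Q))"
      using A(3) fin[of "insert p Q"] Q by (intro card_inj_on_le) (auto simp: h_def)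
    moreover have "card (Sigma (G Q) A) = (\<Sum>f\<in>G Q. card (A f))"
      using fin[OF Q(1,2)] A(1) by (intro card_SigmaI) auto
    ultimately have "(\<Sum>f\<in>G Q. real (card (A f))) \<le> card (G (insert p Q))"
      by (simp flip: of_nat_sum)
    moreover have "a * card (G Q) \<le> (\<Sum>f\<in>G Q. real (card (A f)))"
      using sum_mono[of "G Q" "\<lambda>_. a" "\<lambda>f. real (card (A f))"] A(2) by (simp add: mult.commute)
    ultimately have "a * card (G Q) \<le> card (G (insert p Q))"
      by linarith
    moreover have "a * (a ^ card E * card (G P)) \<le> a * card (G Q)"
      using insert \<open>0 \<le> a\<close> by (intro mult_left_mono) (auto simp: Q_def)
    ultimately show ?case
      using insert.hyps by (simp add: Q_def mult_ac)
  qed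
  then show ?thesis using assms(1) by blast
qed

text \<open>Fill the matrix entry by entry, the diagonal first. An entry then has to lie in at most
  \<open>q\<close> neighbourhoods: on the diagonal those of other diagonal entries, elsewhere those
  of the other entries of its row and of \<open>x i\<close>. Besides, it avoids \<open>U j\<close>
  and at most \<open>q\<close> further vertices, so \<open>a\<close> choices always remain.\<close>

lemma many_absorbers:
  fixes V U :: "nat \<Rightarrow> 'a set" and \<kappa> a u :: real
  assumes V: "\<And>j. j < q \<Longrightarrow> finite (V j) \<and> card (V j) = n"
    and sym: "\<And>u v. adj u v \<Longrightarrow> adj v u"
    and nonadj: "\<And>i j v. i < q \<Longrightarrow> j < q \<Longrightarrow> i \<noteq> j \<Longrightarrow> v \<in> V i \<Longrightarrow> card {u \<in> V j. \<not> adj v u} \<le> \<kappa> * n"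
    and U: "\<And>j. j < q \<Longrightarrow> finite (U j) \<and> card (U j) \<le> u"
    and x: "\<And>j. j < q \<Longrightarrow> x j \<in> V j"
    and "0 \<le> \<kappa>" "0 \<le> a" "a \<le> n - q * (\<kappa> * n) - q - u"
  shows "a ^ (q * q) \<le> card {S \<in> PiE ({..<q} \<times> {..<q}) (\<lambda>p. V (snd p)).
    absorbs q adj S x \<and> (\<forall>j<q. col_set q S j \<inter> U j = {})}"
proof -
  \<comment> \<open>Positions whose entries must be adjacent: two in the same row or two on the
    diagonal.\<close>
  define linked :: "nat \<times> nat \<Rightarrow> nat \<times> nat \<Rightarrow> bool" where
    "linked p p' \<longleftrightarrow> snd p \<noteq> snd p' \<and> (fst p = fst p' \<or> fst p = snd p \<and> fst p' = snd p')" for p p'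
  define ok where "ok p v \<longleftrightarrow> v \<in> V (snd p) \<and> v \<notin> U (snd p) \<and> v \<noteq> x (snd p) \<and>
    (fst p \<noteq> snd p \<longrightarrow> adj (x (fst p)) v)" for p v
  define ok2 where "ok2 p v p' v' \<longleftrightarrow> (snd p = snd p' \<longrightarrow> v \<noteq> v') \<and> (linked p p' \<longrightarrow> adj v v')"
    for p p' and v v' :: 'a
  define G where "G Q = {f \<in> extensional Q. (\<forall>p\<in>Q. ok p (f p)) \<and>
    (\<forall>p\<in>Q. \<forall>p'\<in>Q. p \<noteq> p' \<longrightarrow> ok2 p (f p) p' (f p'))}" for Q
  have ok2_sym: "ok2 p v p' v' \<longleftrightarrow> ok2 p' v' p v" for p v p' v'
    using sym by (auto simp: ok2_def linked_def)
  define Pos where "Pos = {..<q} \<times> {..<q}"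
  define Diag where "Diag = (\<lambda>k. (k, k)) ` {..<q}"
  have G_PiE: "G Q \<subseteq> PiE Q (\<lambda>p. V (snd p))" for Q
    by (auto simp: G_def ok_def PiE_def)
  have finG: "finite (G Q)" if "Q \<subseteq> Pos" for Q
  proof (rule finite_subset[OF G_PiE])
    have "finite Q" using that by (rule finite_subset) (simp add: Pos_def)
    then show "finite (PiE Q (\<lambda>p. V (snd p)))"
      using that V by (intro finite_PiE) (auto simp: Pos_def)
  qed
  have extend: "\<exists>A. finite A \<and> a \<le> card A \<and> (\<forall>v\<in>A. f(p := v) \<in> G (insert p Q))"
    if Q: "Q \<subseteq> Pos" and p: "p \<in> Pos - Q" and diag: "p \<in> Diag \<Longrightarrow> Q \<subseteq> Diag" and f: "f \<in> G Q" for Q p f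
  proof -
    obtain i j where ij: "p = (i, j)" "i < q" "j < q"
      using p by (auto simp: Pos_def)
    \<comment> \<open>\<open>c k\<close> is the only position of class \<open>k\<close> that can be
      linked to \<open>p\<close> among those filled so far.\<close>
    define c where "c k = (if i = j then (k, k) else (i, k))" for k
    define E where "E = c ` ({..<q} - {j}) \<inter> Q"
    define C where "C = {p' \<in> Q. snd p' = j}"
    define N where "N v = {u \<in> V j. \<not> adj v u}" for v
    define bad where "bad = U j \<union> insert (x j) (f ` C) \<union> (\<Union>p'\<in>E. N (f p')) \<union> (if i = j then {} else N (x i))"
    have E: "p' \<in> E" if "p' \<in> Q" "linked p p'" for p'
    proof -
      have snd: "snd p' < q" "snd p' \<noteq> j"
        using that Q ij by (auto simp: Pos_def linked_def)
      have "p' = c (snd p')"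
      proof (cases "i = j")
        case True
        have "p \<in> Diag" unfolding Diag_def ij(1) True using ij(3) by blast
        then have "p' \<in> Diag" using diag that(1) by blast
        then show ?thesis using True by (auto simp: c_def Diag_def)
      next
        case False
        then have "fst p' = i" using that(2) ij(1) by (simp add: linked_def)
        then show ?thesis using False by (simp add: c_def prod_eq_iff)
      qed
      then show ?thesis using snd that(1) by (auto simp: E_def)
    qed
    have finQ: "finite Q" using Q by (rule finite_subset) (simp add: Pos_def)
    have "card E \<le> card (c ` ({..<q} - {j}))"
      unfolding E_def by (intro card_mono) auto
    also have "\<dots> \<le> card ({..<q} - {j})"
      by (intro card_image_le) simp
    finally have cE: "card E \<le> q - 1"
      using ij by simp
    have "C \<subseteq> (\<lambda>k. (k, j)) ` ({..<q} - {i})"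
      using Q p ij by (auto simp: C_def Pos_def)
    then have "card C \<le> card ((\<lambda>k. (k, j)) ` ({..<q} - {i}))"
      by (intro card_mono) auto
    also have "\<dots> \<le> card ({..<q} - {i})"
      by (intro card_image_le) simp
    finally have "card C \<le> q - 1"
      using ij by simp
    moreover have "card (f ` C) \<le> card C"
      using finQ by (intro card_image_le) (simp add: C_def)
    ultimately have cC: "card (insert (x j) (f ` C)) \<le> q"
      using ij by (intro card_insert_le_m1) auto
    have fQ: "f p' \<in> V (snd p')" if "p' \<in> Q" for p'
      using f that by (auto simp: G_def ok_def)
    have finN: "finite (N v)" for v using V ij by (simp add: N_def)
    have cN: "card (N (f p')) \<le> \<kappa> * n" if pE: "p' \<in> E" for p'
    proof -
      obtain k where k: "p' = c k" "k < q" "k \<noteq> j" "p' \<in> Q" using pE unfolding E_def by blast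
      then have "snd p' = k" by (simp add: c_def)
      with k have "p' \<in> Q" "snd p' < q" "snd p' \<noteq> j" by simp_all
      then show ?thesis using nonadj[of "snd p'" j "f p'"] fQ ij by (simp add: N_def)
    qed
    have finE: "finite E" by (simp add: E_def)
    have "real (card (\<Union>p'\<in>E. N (f p'))) \<le> (\<Sum>p'\<in>E. real (card (N (f p'))))"
      using card_UN_le[OF finE, of "\<lambda>p'. N (f p')"] by (simp flip: of_nat_sum)
    also have "\<dots> \<le> card E * (\<kappa> * n)"
      using sum_mono[of E "\<lambda>p'. real (card (N (f p')))" "\<lambda>_. \<kappa> * n"] cN by simp
    also have "\<dots> \<le> (real q - 1) * (\<kappa> * n)"
      using cE ij \<open>0 \<le> \<kappa>\<close> by (intro mult_right_mono) auto
    finally have c1: "real (card (\<Union>p'\<in>E. N (f p'))) \<le> (real q - 1) * (\<kappa> * n)" .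
    have c2: "real (card (if i = j then {} else N (x i))) \<le> \<kappa> * n"
      using nonadj[of i j "x i"] x ij \<open>0 \<le> \<kappa>\<close> by (simp add: N_def)
    have "card bad \<le> card (U j) + card (insert (x j) (f ` C)) + card (\<Union>p'\<in>E. N (f p'))
        + card (if i = j then {} else N (x i))"
      unfolding bad_def by (intro order_trans[OF card_Un_le] add_mono order_refl)
    then have "real (card bad) \<le> card (U j) + real (card (insert (x j) (f ` C))) + card (\<Union>p'\<in>E. N (f p'))
        + card (if i = j then {} else N (x i))"
      by (simp only: of_nat_le_iff flip: of_nat_add)
    also have "\<dots> \<le> u + q + (real q - 1) * (\<kappa> * n) + \<kappa> * n"
      using c1 c2 cC U[OF ij(3)] by linarith
    finally have cbad: "real (card bad) \<le> u + q + q * (\<kappa> * n)"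
      by (simp add: algebra_simps)
    have finbad: "finite bad"
      using U[OF ij(3)] finQ finE finN by (simp add: bad_def C_def)
    have "n - card bad \<le> card (V j - bad)"
      using diff_card_le_card_Diff[OF finbad, of "V j"] V ij by simp
    then have "a \<le> card (V j - bad)"
      using cbad assms(8) by linarith
    moreover have "f(p := v) \<in> G (insert p Q)" if v: "v \<in> V j - bad" for v
    proof -
      have okp: "ok p v"
        using v ij by (auto simp: ok_def bad_def N_def)
      have ok2p: "ok2 p v p' (f p')" if "p' \<in> Q" for p'
      proof -
        have "v \<noteq> f p'" if "snd p = snd p'"
          using v that \<open>p' \<in> Q\<close> ij by (auto simp: bad_def C_def)
        moreover have "adj v (f p')" if "linked p p'"
          using E[OF \<open>p' \<in> Q\<close> that] v sym by (auto simp: bad_def N_def)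
        ultimately show ?thesis by (simp add: ok2_def)
      qed
      have "p \<notin> Q" using p by simp
      show ?thesis
        unfolding G_def
      proof (intro CollectI conjI ballI impI)
        show "f(p := v) \<in> extensional (insert p Q)"
          using f by (auto simp: G_def extensional_def)
        show "ok r ((f(p := v)) r)" if "r \<in> insert p Q" for r
          using that okp f \<open>p \<notin> Q\<close> by (auto simp: G_def)
        show "ok2 r ((f(p := v)) r) s ((f(p := v)) s)" if rs: "r \<in> insert p Q" "s \<in> insert p Q" "r \<noteq> s" for r s
        proof -
          consider "r = p" "s \<in> Q" "s \<noteq> p" | "s = p" "r \<in> Q" "r \<noteq> p" | "r \<in> Q" "s \<in> Q" "r \<noteq> p" "s \<noteq> p"
            using rs \<open>p \<notin> Q\<close> by blast
          then show ?thesis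
          proof cases
            case 1
            then show ?thesis using ok2p by simp
          next
            case 2
            then show ?thesis using ok2p[of r] by (subst ok2_sym) simp
          next
            case 3
            then show ?thesis using f rs(3) by (simp add: G_def)
          qed
        qed
      qed
    qed
    ultimately show ?thesis
      using V ij by (intro exI[of _ "V j - bad"]) auto
  qed
  have DP: "Diag \<subseteq> Pos" by (auto simp: Diag_def Pos_def)
  have extn: "f \<in> extensional Q" if "f \<in> G Q" for f Q
    using that by (simp add: G_def)
  \<comment> \<open>The diagonal goes first: a diagonal entry placed later could face constraints
    from its row and from the diagonal at once.\<close>
  have "a ^ card Diag * card (G {}) \<le> card (G ({} \<union> Diag))"
  proof (rule card_ge_power_of_extensions)
    show "\<exists>A. finite A \<and> a \<le> card A \<and> (\<forall>v\<in>A. f(p := v) \<in> G (insert p Q))"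
      if "Q \<subseteq> {} \<union> Diag" "p \<in> Diag - Q" "f \<in> G Q" for Q p f
      using that DP by (intro extend) auto
  qed (use DP finG extn \<open>0 \<le> a\<close> in \<open>auto simp: Diag_def\<close>)
  moreover have "G {} = {\<lambda>_. undefined}" by (auto simp: G_def)
  ultimately have c1: "a ^ card Diag \<le> card (G Diag)" by simp
  have "a ^ card (Pos - Diag) * card (G Diag) \<le> card (G (Diag \<union> (Pos - Diag)))"
  proof (rule card_ge_power_of_extensions)
    show "\<exists>A. finite A \<and> a \<le> card A \<and> (\<forall>v\<in>A. f(p := v) \<in> G (insert p Q))"
      if "Q \<subseteq> Diag \<union> (Pos - Diag)" "p \<in> Pos - Diag - Q" "f \<in> G Q" for Q p f
      using that DP by (intro extend) auto
    show "finite (G Q)" if "Q \<subseteq> Diag \<union> (Pos - Diag)" for Q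
      using that DP by (intro finG) auto
    show "finite (Pos - Diag)" by (simp add: Pos_def)
  qed (use extn \<open>0 \<le> a\<close> in auto)
  moreover have "Diag \<union> (Pos - Diag) = Pos" using DP by auto
  moreover have "a ^ card (Pos - Diag) * a ^ card Diag \<le> a ^ card (Pos - Diag) * card (G Diag)"
    using c1 \<open>0 \<le> a\<close> by (intro mult_left_mono) auto
  moreover have "card (Pos - Diag) + card Diag = q * q"
  proof -
    have finP: "finite Pos" by (simp add: Pos_def)
    have "card (Pos - Diag) + card Diag = card Pos"
      using card_Diff_subset[OF finite_subset[OF DP finP] DP] card_mono[OF finP DP] by simp
    then show ?thesis by (simp add: Pos_def)
  qed
  ultimately have "a ^ (q * q) \<le> card (G Pos)"
    by (metis (no_types, lifting) order_trans power_add)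
  also have "card (G Pos) \<le> card {S \<in> PiE Pos (\<lambda>p. V (snd p)).
    absorbs q adj S x \<and> (\<forall>j<q. col_set q S j \<inter> U j = {})}"
  proof (rule card_mono)
    show "finite {S \<in> PiE Pos (\<lambda>p. V (snd p)). absorbs q adj S x \<and> (\<forall>j<q. col_set q S j \<inter> U j = {})}"
      using V by (intro finite_subset[OF Collect_restrict] finite_PiE) (auto simp: Pos_def)
    show "G Pos \<subseteq> {S \<in> PiE Pos (\<lambda>p. V (snd p)). absorbs q adj S x \<and> (\<forall>j<q. col_set q S j \<inter> U j = {})}"
    proof
      fix S assume S: "S \<in> G Pos"
      have ok: "ok (i, j) (S (i, j))" if "i < q" "j < q" for i j
        using S that by (auto simp: G_def Pos_def)
      have ok2: "ok2 (i, j) (S (i, j)) (i', j') (S (i', j'))"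
        if "i < q" "j < q" "i' < q" "j' < q" "(i, j) \<noteq> (i', j')" for i j i' j'
        using S that by (auto simp: G_def Pos_def)
      have row: "adj (S (i, j)) (S (i, j'))" if "i < q" "j < q" "j' < q" "j \<noteq> j'" for i j j'
        using ok2[of i j i j'] that by (simp add: ok2_def linked_def)
      have dia: "adj (S (i, i)) (S (j, j))" if "i < q" "j < q" "i \<noteq> j" for i j
        using ok2[of i i j j] that by (simp add: ok2_def linked_def)
      have xrow: "adj (x i) (S (i, j))" if "i < q" "j < q" "i \<noteq> j" for i j
        using ok[of i j] that by (simp add: ok_def)
      have "inj_on (\<lambda>i. S (i, j)) {..<q}" if "j < q" for j
        using ok2[of _ j _ j] that by (intro inj_onI) (auto simp: ok2_def)
      moreover have "x j \<notin> col_set q S j" "col_set q S j \<inter> U j = {}" if "j < q" for j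
      proof -
        have "v \<noteq> x j \<and> v \<notin> U j" if "v \<in> col_set q S j" for v
          using that ok[OF _ \<open>j < q\<close>] by (auto simp: ok_def col_set_def)
        then show "x j \<notin> col_set q S j" "col_set q S j \<inter> U j = {}" by blast+
      qed
      moreover have "clique_on q adj (\<lambda>j. S (i, j))" "clique_on q adj ((\<lambda>j. S (i, j))(i := x i))" if "i < q" for i
        using row xrow that sym by (auto simp: clique_on_def)
      moreover have "clique_on q adj (\<lambda>j. S (j, j))"
        using dia by (auto simp: clique_on_def)
      ultimately show "S \<in> {S \<in> PiE Pos (\<lambda>p. V (snd p)). absorbs q adj S x \<and> (\<forall>j<q. col_set q S j \<inter> U j = {})}"
        using subsetD[OF G_PiE S] by (simp add: absorbs_def)
    qed
  qed
  finally show ?thesis by (simp add: Pos_def)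
qed

lemma power_le_exp_linear_eventually:
  fixes c C :: real
  assumes "c > 0" "C > 0"
  shows "\<forall>\<^sub>F n in sequentially. C * real n ^ k \<le> exp (c * n)"
proof -
  have "((\<lambda>n. (c * real n) ^ k / exp (c * real n)) \<longlongrightarrow> 0) sequentially"
    by (rule filterlim_compose[OF tendsto_power_div_exp_0])
      (intro filterlim_tendsto_pos_mult_at_top[OF tendsto_const \<open>c > 0\<close>] filterlim_real_sequentially)
  then have "\<forall>\<^sub>F n in sequentially. (c * real n) ^ k / exp (c * real n) < c ^ k / C"
    using assms by (intro order_tendstoD(2)) auto
  then show ?thesis
  proof eventually_elim
    case (elim n)
    then have "c ^ k * (C * real n ^ k) < c ^ k * exp (c * n)"
      using assms by (simp add: field_simps power_mult_distrib)
    then show ?case using assms by (simp add: mult_less_cancel_left_pos)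
  qed
qed

text \<open>Apply the greedy selection to all matrices, with \<open>absorbs\<close> as the hitting
  relation and column-wise disjointness as compatibility. In each class the chosen matrices occupy
  at most a third of the slack \<open>1 - q * \<kappa>\<close>, so enough absorbers stay free at
  each step.\<close>

lemma absorbing_family:
  fixes \<kappa> :: real
  assumes "q > 0" "0 \<le> \<kappa>" "\<kappa> < 1 / q"
  shows "\<exists>\<gamma>::real. 0 < \<gamma> \<and> \<gamma> \<le> 1 \<and> (\<forall>\<^sub>F n in sequentially. \<forall>(V :: nat \<Rightarrow> 'a set) adj.
    dense_multipartite q adj V n \<kappa> \<longrightarrow>
    (\<exists>F. finite F \<and> q * card F \<le> (1 - q * \<kappa>) / 3 * n \<and>
      (\<forall>S\<in>F. (\<exists>x. absorbs q adj S x) \<and> (\<forall>j<q. col_set q S j \<subseteq> V j)) \<and>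
      (\<forall>S\<in>F. \<forall>S'\<in>F. S \<noteq> S' \<longrightarrow> (\<forall>j<q. col_set q S j \<inter> col_set q S' j = {})) \<and>
      (\<forall>x. (\<forall>j<q. x j \<in> V j) \<longrightarrow> nat \<lceil>\<gamma> * n\<rceil> \<le> card {S \<in> F. absorbs q adj S x})))"
proof -
  define \<rho> where "\<rho> = 1 - q * \<kappa>"
  have \<rho>: "0 < \<rho>" "\<rho> \<le> 1"
    using assms by (auto simp: \<rho>_def field_simps)
  \<comment> \<open>\<open>\<beta> * n\<close> matrices occupy at most \<open>\<rho> / 3 * n\<close>
    vertices per class. With this and \<open>q \<le> \<rho> / 3 * n\<close> subtracted from
    \<open>\<rho> * n\<close>, every entry still has \<open>\<rho> / 3 * n\<close> choices, whence
    \<open>p\<close>. The choice of \<open>\<gamma>\<close> makes \<open>p / 2 * \<beta> * n\<close>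
    equal to \<open>2 * \<gamma> * n\<close>: one \<open>\<gamma> * n\<close> pays for the
    \<open>n ^ q\<close> transversals, the other for \<open>r\<close>.\<close>
  define \<beta> where "\<beta> = \<rho> / (3 * q)"
  define p where "p = (\<rho> / 3) ^ (q * q)"
  define \<gamma> where "\<gamma> = \<beta> * p / 4"
  have \<beta>: "0 < \<beta>" "\<beta> \<le> 1"
    using \<rho> \<open>q > 0\<close> by (auto simp: \<beta>_def field_simps)
  have p: "0 < p" "p \<le> 1"
    using \<rho> by (auto simp: p_def intro: power_le_one)
  have \<gamma>: "0 < \<gamma>" "\<gamma> \<le> 1"
  proof -
    show "0 < \<gamma>" using \<beta> p by (simp add: \<gamma>_def)
    have "\<beta> * p \<le> 1 * 1" using \<beta> p by (intro mult_mono) auto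
    then show "\<gamma> \<le> 1" by (simp add: \<gamma>_def)
  qed
  have "\<forall>\<^sub>F n in sequentially. \<forall>(V :: nat \<Rightarrow> 'a set) adj.
    dense_multipartite q adj V n \<kappa> \<longrightarrow>
    (\<exists>F. finite F \<and> q * card F \<le> \<rho> / 3 * n \<and>
      (\<forall>S\<in>F. (\<exists>x. absorbs q adj S x) \<and> (\<forall>j<q. col_set q S j \<subseteq> V j)) \<and>
      (\<forall>S\<in>F. \<forall>S'\<in>F. S \<noteq> S' \<longrightarrow> (\<forall>j<q. col_set q S j \<inter> col_set q S' j = {})) \<and>
      (\<forall>x. (\<forall>j<q. x j \<in> V j) \<longrightarrow> nat \<lceil>\<gamma> * n\<rceil> \<le> card {S \<in> F. absorbs q adj S x}))"
    using power_le_exp_linear_eventually[OF \<gamma>(1) exp_gt_zero, of 2 q] eventually_ge_at_top[of "nat \<lceil>3 * q / \<rho>\<rceil>"]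
      eventually_gt_at_top[of 0]
  proof (eventually_elim, intro allI impI)
    fix n :: nat and V :: "nat \<Rightarrow> 'a set" and adj
    assume n_exp: "exp 2 * real n ^ q \<le> exp (\<gamma> * n)" and n_large: "nat \<lceil>3 * q / \<rho>\<rceil> \<le> n" and "0 < n" and "dense_multipartite q adj V n \<kappa>"
    then have V: "\<forall>j<q. finite (V j) \<and> card (V j) = n"
      and sym: "\<forall>u v. adj u v \<longrightarrow> adj v u"
      and nonadj: "\<forall>i<q. \<forall>j<q. i \<noteq> j \<longrightarrow> (\<forall>v\<in>V i. card {u \<in> V j. \<not> adj v u} \<le> \<kappa> * n)"
      by (auto simp: dense_multipartite_def)
    define M where "M = nat \<lfloor>\<beta> * n\<rfloor>"
    define r where "r = nat \<lceil>\<gamma> * n\<rceil>"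
    define \<S> where "\<S> = PiE ({..<q} \<times> {..<q}) (\<lambda>p. V (snd p))"
    define X where "X = PiE {..<q} V"
    define free_of where "free_of S S' \<longleftrightarrow> (\<forall>j<q. col_set q S j \<inter> col_set q S' j = {})"
      for S S' :: "nat \<times> nat \<Rightarrow> 'a"
    have \<beta>n: "0 \<le> \<beta> * n" using \<beta> by simp
    have M: "real M \<le> \<beta> * n" "\<beta> * n - 1 \<le> M"
      using \<beta>n unfolding M_def by linarith+
    have qM: "q * M \<le> \<rho> / 3 * n"
    proof -
      have "q * real M \<le> q * (\<beta> * n)" using M by (intro mult_left_mono) auto
      then show ?thesis using \<open>q > 0\<close> by (simp add: \<beta>_def)
    qed
    have "(\<Prod>p\<in>{..<q} \<times> {..<q}. card (V (snd p))) = (\<Prod>p\<in>{..<q} \<times> {..<q}. n)"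
      using V by (intro prod.cong) auto
    then have \<S>: "finite \<S>" "card \<S> = n ^ (q * q)"
      using V by (auto simp: \<S>_def card_PiE intro!: finite_PiE)
    have X: "finite X" "card X = n ^ q"
      using V by (auto simp: X_def card_PiE intro!: finite_PiE)
    have "\<exists>F\<subseteq>\<S>. card F = M \<and> (\<forall>S\<in>F. \<forall>S'\<in>F. S \<noteq> S' \<longrightarrow> free_of S S') \<and>
      (\<forall>x\<in>X. r \<le> card {S \<in> F. absorbs q adj S x})"
    proof (rule compatible_family_hitting_often[OF \<S>(1) X(1) _ _ p(1)])
      show "X \<noteq> {}" "\<S> \<noteq> {}"
        using X \<S> \<open>0 < n\<close> by (metis card.empty power_eq_0_iff less_irrefl)+
      show "\<not> free_of S S" for S
        using \<open>q > 0\<close> by (auto simp: free_of_def col_set_def)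
      show "free_of S' S" if "free_of S S'" for S S'
        using that by (auto simp: free_of_def)
      show "p * card \<S> \<le> card {S \<in> \<S>. absorbs q adj S x \<and> (\<forall>S'\<in>F. free_of S S')}"
        if F: "F \<subseteq> \<S>" "card F < M" and x: "x \<in> X" for F x
      proof -
        define U where "U j = (\<Union>S\<in>F. col_set q S j)" for j
        have finF: "finite F" using F \<S> finite_subset by blast
        have "(\<rho> / 3 * n) ^ (q * q) \<le> card {S \<in> \<S>. absorbs q adj S x \<and> (\<forall>j<q. col_set q S j \<inter> U j = {})}"
          unfolding \<S>_def
        proof (rule many_absorbers[where \<kappa> = \<kappa> and u = "\<rho> / 3 * n" and n = n])
          show "finite (U j) \<and> real (card (U j)) \<le> \<rho> / 3 * n" if "j < q" for j
          proof
            show "finite (U j)" using finF by (simp add: U_def col_set_def)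
            have "card (U j) \<le> (\<Sum>S\<in>F. card (col_set q S j))"
              unfolding U_def by (rule card_UN_le[OF finF])
            also have "\<dots> \<le> (\<Sum>S\<in>F. q)"
              unfolding col_set_def by (intro sum_mono) (metis card_image_le card_lessThan finite_lessThan)
            also have "\<dots> \<le> q * M" using F(2) by simp
            finally have "real (card (U j)) \<le> real (q * M)" by (simp only: of_nat_le_iff)
            then show "real (card (U j)) \<le> \<rho> / 3 * n" using qM by linarith
          qed
          have "3 * q / \<rho> \<le> n" using n_large by linarith
          then have "real q \<le> \<rho> / 3 * n" using \<rho> by (simp add: field_simps)
          moreover have "n - q * (\<kappa> * n) = \<rho> * n" by (simp add: \<rho>_def algebra_simps)
          ultimately show "\<rho> / 3 * n \<le> n - q * (\<kappa> * n) - q - \<rho> / 3 * n" by simp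
        qed (use V sym nonadj x assms \<rho> in \<open>auto simp: X_def\<close>)
        also have "{S \<in> \<S>. absorbs q adj S x \<and> (\<forall>j<q. col_set q S j \<inter> U j = {})}
          = {S \<in> \<S>. absorbs q adj S x \<and> (\<forall>S'\<in>F. free_of S S')}"
          by (auto simp: U_def free_of_def)
        also have "(\<rho> / 3 * n) ^ (q * q) = p * card \<S>"
          unfolding p_def \<S>(2) of_nat_power by (rule power_mult_distrib)
        finally show ?thesis .
      qed
      \<comment> \<open>The factor \<open>exp 2\<close> in \<open>n_exp\<close> covers the rounding:
        one \<open>exp 1\<close> for the floor in \<open>M\<close>, another for the ceiling in
        \<open>r\<close>.\<close>
      show "card X * (1 - p / 2) ^ M \<le> (1 / 2) ^ r"
      proof -
        have "(1 - p / 2) ^ M \<le> exp (- p / 2) ^ M"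
          using p exp_ge_add_one_self[of "- p / 2"] by (intro power_mono) auto
        also have "\<dots> = exp (- (p / 2 * M))"
          by (simp add: exp_of_nat_mult[symmetric])
        also have "\<dots> \<le> exp (1 - 2 * (\<gamma> * n))"
        proof -
          have "p / 2 * (\<beta> * n - 1) \<le> p / 2 * M"
            using M p by (intro mult_left_mono) auto
          moreover have "p / 2 * (\<beta> * n - 1) = 2 * (\<gamma> * n) - p / 2"
            by (simp add: \<gamma>_def algebra_simps)
          ultimately show ?thesis unfolding exp_le_cancel_iff using p by linarith
        qed
        finally have "card X * (1 - p / 2) ^ M \<le> real n ^ q * exp (1 - 2 * (\<gamma> * n))"
          by (simp add: X(2) mult_left_mono)
        also have "\<dots> = (exp 2 * real n ^ q) * exp (- 1 - 2 * (\<gamma> * n))"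
          by (simp add: exp_add[symmetric] mult.commute mult.left_commute)
        also have "\<dots> \<le> exp (\<gamma> * n) * exp (- 1 - 2 * (\<gamma> * n))"
          using n_exp by (intro mult_right_mono) auto
        also have "\<dots> = exp (- (\<gamma> * n + 1))"
          by (simp add: exp_add[symmetric])
        also have "\<dots> \<le> exp (- real r)"
        proof -
          have "0 \<le> \<gamma> * n" using \<gamma> by simp
          then have "real r \<le> \<gamma> * n + 1" unfolding r_def by linarith
          then show ?thesis by simp
        qed
        also have "\<dots> = exp (- 1) ^ r"
          by (simp add: exp_of_nat_mult[symmetric])
        also have "\<dots> \<le> (1 / 2) ^ r"
          using exp_ge_add_one_self[of 1] by (intro power_mono) (auto simp: exp_minus field_simps)
        finally show ?thesis .
      qed
    qed
    then obtain F where F: "F \<subseteq> \<S>" "card F = M" "\<forall>S\<in>F. \<forall>S'\<in>F. S \<noteq> S' \<longrightarrow> free_of S S'"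
      "\<forall>x\<in>X. r \<le> card {S \<in> F. absorbs q adj S x}" by blast
    \<comment> \<open>Members that absorb nothing are dropped: their rows need not be cliques, so
      nothing guarantees a tiling of their entries.\<close>
    define F' where "F' = {S \<in> F. \<exists>x. absorbs q adj S x}"
    have finF: "finite F" using F(1) \<S>(1) finite_subset by blast
    show "\<exists>F. finite F \<and> q * card F \<le> \<rho> / 3 * n \<and>
      (\<forall>S\<in>F. (\<exists>x. absorbs q adj S x) \<and> (\<forall>j<q. col_set q S j \<subseteq> V j)) \<and>
      (\<forall>S\<in>F. \<forall>S'\<in>F. S \<noteq> S' \<longrightarrow> (\<forall>j<q. col_set q S j \<inter> col_set q S' j = {})) \<and>
      (\<forall>x. (\<forall>j<q. x j \<in> V j) \<longrightarrow> nat \<lceil>\<gamma> * n\<rceil> \<le> card {S \<in> F. absorbs q adj S x})"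
    proof (intro exI[of _ F'] conjI)
      show "finite F'" using finF by (simp add: F'_def)
      have "card F' \<le> M" using F(2) finF by (auto simp: F'_def intro: card_mono)
      then have "real (q * card F') \<le> real (q * M)" unfolding of_nat_le_iff by (rule mult_le_mono2)
      then show "real (q * card F') \<le> \<rho> / 3 * n" using qM by linarith
      have "col_set q S j \<subseteq> V j" if "S \<in> F" "j < q" for S j
      proof -
        have "S \<in> \<S>" using that F(1) by blast
        then show ?thesis using that by (auto simp: \<S>_def col_set_def PiE_iff)
      qed
      then show "\<forall>S\<in>F'. (\<exists>x. absorbs q adj S x) \<and> (\<forall>j<q. col_set q S j \<subseteq> V j)"
        by (simp add: F'_def)
      show "\<forall>S\<in>F'. \<forall>S'\<in>F'. S \<noteq> S' \<longrightarrow> (\<forall>j<q. col_set q S j \<inter> col_set q S' j = {})"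
        using F(3) by (simp add: F'_def free_of_def)
      show "\<forall>x. (\<forall>j<q. x j \<in> V j) \<longrightarrow> nat \<lceil>\<gamma> * n\<rceil> \<le> card {S \<in> F'. absorbs q adj S x}"
      proof (intro allI impI)
        fix x assume "\<forall>j<q. x j \<in> V j"
        then have "restrict x {..<q} \<in> X" by (auto simp: X_def)
        from bspec[OF F(4) this] have "r \<le> card {S \<in> F. absorbs q adj S x}"
          unfolding absorbs_restrict .
        moreover have "{S \<in> F'. absorbs q adj S x} = {S \<in> F. absorbs q adj S x}"
          by (auto simp: F'_def)
        ultimately show "nat \<lceil>\<gamma> * n\<rceil> \<le> card {S \<in> F'. absorbs q adj S x}"
          by (simp add: r_def)
      qed
    qed
  qed
  then show ?thesis using \<gamma> unfolding \<rho>_def by blast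
qed

section \<open>Perfect tilings from absorption and almost perfect tilings\<close>

text \<open>Reserving the absorbers leaves at least \<open>(1 - \<rho> / 3) * n\<close> vertices in
  each class, which raises the missed ratio from \<open>\<kappa>\<close> to at most
  \<open>\<kappa>'\<close>. Since \<open>q * \<kappa> = 1 - \<rho>\<close>, this is still below
  \<open>1 / q\<close>, so the almost perfect tiling applies to the rest.\<close>

lemma multipartite_tiling:
  fixes \<kappa> :: real
  assumes "q > 0" "0 \<le> \<kappa>" "\<kappa> < 1 / q"
  shows "\<forall>\<^sub>F n in sequentially. \<forall>(V :: nat \<Rightarrow> 'a set) adj.
    dense_multipartite q adj V n \<kappa> \<longrightarrow>
    tileable q adj V"
proof -
  define \<rho> where "\<rho> = 1 - q * \<kappa>"
  have \<rho>: "0 < \<rho>" "\<rho> \<le> 1"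
    using assms by (auto simp: \<rho>_def field_simps)
  define \<kappa>' where "\<kappa>' = \<kappa> / (1 - \<rho> / 3)"
  have "q * \<kappa> = 1 - \<rho>" by (simp add: \<rho>_def)
  then have "q * \<kappa> < 1 - \<rho> / 3" using \<rho> by linarith
  then have \<kappa>': "0 \<le> \<kappa>'" "\<kappa>' < 1 / q"
    using assms \<rho> by (simp_all add: \<kappa>'_def field_simps)
  obtain \<gamma> :: real where \<gamma>: "0 < \<gamma>" "\<gamma> \<le> 1" and ev: "\<forall>\<^sub>F n in sequentially. \<forall>(V :: nat \<Rightarrow> 'a set) adj.
    dense_multipartite q adj V n \<kappa> \<longrightarrow>
    (\<exists>F. finite F \<and> q * card F \<le> \<rho> / 3 * n \<and>
      (\<forall>S\<in>F. (\<exists>x. absorbs q adj S x) \<and> (\<forall>j<q. col_set q S j \<subseteq> V j)) \<and>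
      (\<forall>S\<in>F. \<forall>S'\<in>F. S \<noteq> S' \<longrightarrow> (\<forall>j<q. col_set q S j \<inter> col_set q S' j = {})) \<and>
      (\<forall>x. (\<forall>j<q. x j \<in> V j) \<longrightarrow> nat \<lceil>\<gamma> * n\<rceil> \<le> card {S \<in> F. absorbs q adj S x}))"
    using absorbing_family[OF assms] unfolding \<rho>_def by blast
  obtain N0 where N0: "\<forall>N\<ge>N0. \<forall>(W :: nat \<Rightarrow> 'a set) adj.
    dense_multipartite q adj W N \<kappa>' \<longrightarrow>
    (\<exists>R. (\<forall>j<q. R j \<subseteq> W j \<and> card (R j) = nat \<lceil>\<gamma> * N\<rceil>) \<and> tileable q adj (\<lambda>j. W j - R j))"
    using almost_tiling[OF assms(1) \<kappa>' \<gamma>] unfolding eventually_sequentially by blast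
  show ?thesis
    using ev eventually_ge_at_top[of "2 * N0"]
  proof (eventually_elim, intro allI impI)
    fix n and V :: "nat \<Rightarrow> 'a set" and adj
    assume fam: "\<forall>(V :: nat \<Rightarrow> 'a set) adj. dense_multipartite q adj V n \<kappa> \<longrightarrow>
      (\<exists>F. finite F \<and> q * card F \<le> \<rho> / 3 * n \<and>
        (\<forall>S\<in>F. (\<exists>x. absorbs q adj S x) \<and> (\<forall>j<q. col_set q S j \<subseteq> V j)) \<and>
        (\<forall>S\<in>F. \<forall>S'\<in>F. S \<noteq> S' \<longrightarrow> (\<forall>j<q. col_set q S j \<inter> col_set q S' j = {})) \<and>
        (\<forall>x. (\<forall>j<q. x j \<in> V j) \<longrightarrow> nat \<lceil>\<gamma> * n\<rceil> \<le> card {S \<in> F. absorbs q adj S x}))"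
      and n: "2 * N0 \<le> n" and dense: "dense_multipartite q adj V n \<kappa>"
    from dense have V: "\<forall>j<q. finite (V j) \<and> card (V j) = n"
      and sym: "\<forall>u v. adj u v \<longrightarrow> adj v u"
      and nonadj: "\<forall>i<q. \<forall>j<q. i \<noteq> j \<longrightarrow> (\<forall>v\<in>V i. card {u \<in> V j. \<not> adj v u} \<le> \<kappa> * n)"
      by (auto simp: dense_multipartite_def)
    obtain F where "finite F \<and> q * card F \<le> \<rho> / 3 * n \<and>
        (\<forall>S\<in>F. (\<exists>x. absorbs q adj S x) \<and> (\<forall>j<q. col_set q S j \<subseteq> V j)) \<and>
        (\<forall>S\<in>F. \<forall>S'\<in>F. S \<noteq> S' \<longrightarrow> (\<forall>j<q. col_set q S j \<inter> col_set q S' j = {})) \<and>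
        (\<forall>x. (\<forall>j<q. x j \<in> V j) \<longrightarrow> nat \<lceil>\<gamma> * n\<rceil> \<le> card {S \<in> F. absorbs q adj S x})"
      using fam dense by presburger
    then have F: "finite F" "q * card F \<le> \<rho> / 3 * n"
      "\<And>S. S \<in> F \<Longrightarrow> \<exists>x. absorbs q adj S x"
      "\<And>S j. S \<in> F \<Longrightarrow> j < q \<Longrightarrow> col_set q S j \<subseteq> V j"
      "\<And>S S' j. S \<in> F \<Longrightarrow> S' \<in> F \<Longrightarrow> S \<noteq> S' \<Longrightarrow> j < q \<Longrightarrow> col_set q S j \<inter> col_set q S' j = {}"
      "\<And>x. (\<And>j. j < q \<Longrightarrow> x j \<in> V j) \<Longrightarrow> nat \<lceil>\<gamma> * n\<rceil> \<le> card {S \<in> F. absorbs q adj S x}"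
      by simp_all
    define A where "A j = (\<Union>S\<in>F. col_set q S j)" for j
    define N where "N = n - q * card F"
    have cardA: "card (A j) = q * card F" if "j < q" for j
    proof -
      have "card (col_set q S j) = q" if "S \<in> F" for S
        using F(3)[OF that] \<open>j < q\<close> by (auto simp: absorbs_def col_set_def card_image)
      moreover have "card (A j) = (\<Sum>S\<in>F. card (col_set q S j))"
        unfolding A_def using F(1,5) that by (intro card_UN_disjoint) (auto simp: col_set_def)
      ultimately show ?thesis by simp
    qed
    have AV: "A j \<subseteq> V j" if "j < q" for j
      using F(4) that by (auto simp: A_def)
    \<comment> \<open>The absorbers take at most a third of each class, so
      \<open>n \<ge> 2 * N0\<close> leaves at least \<open>N0\<close> vertices.\<close>
    have F3: "real (q * card F) \<le> 1 / 3 * n"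
      using F(2) \<rho> mult_right_mono[of "\<rho> / 3" "1 / 3" "real n"] by simp
    also have "\<dots> \<le> real n" by simp
    finally have "q * card F \<le> n" unfolding of_nat_le_iff .
    then have N2: "real N = n - real (q * card F)" unfolding N_def by (rule of_nat_diff)
    moreover have "real N0 \<le> n / 2" using n by linarith
    ultimately have "real N0 \<le> real N" using F3 by linarith
    then have N: "N \<ge> N0" "real N = n - real (q * card F)" "real N \<ge> (1 - \<rho> / 3) * n"
      using N2 F(2) by (simp_all add: algebra_simps)
    have \<kappa>'N: "\<kappa> * n \<le> \<kappa>' * N"
    proof -
      have "\<kappa> * n = \<kappa>' * ((1 - \<rho> / 3) * n)" using \<rho> by (simp add: \<kappa>'_def)
      also have "\<dots> \<le> \<kappa>' * N" using N(3) \<kappa>' by (intro mult_left_mono) auto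
      finally show ?thesis .
    qed
    have "dense_multipartite q adj (\<lambda>j. V j - A j) N \<kappa>'"
      unfolding dense_multipartite_def
    proof (intro conjI sym)
      show "\<forall>j<q. finite (V j - A j) \<and> card (V j - A j) = N"
      proof (intro allI impI)
        fix j assume j: "j < q"
        then have "finite (A j)" using V AV finite_subset by blast
        then show "finite (V j - A j) \<and> card (V j - A j) = N"
          using V AV cardA j by (simp add: N_def card_Diff_subset)
      qed
      show "\<forall>i<q. \<forall>j<q. i \<noteq> j \<longrightarrow> (\<forall>v\<in>V i - A i. card {u \<in> V j - A j. \<not> adj v u} \<le> \<kappa>' * N)"
      proof (intro allI impI ballI)
        fix i j v assume "i < q" "j < q" "i \<noteq> j" "v \<in> V i - A i"
        then have "real (card {u \<in> V j. \<not> adj v u}) \<le> \<kappa> * n" using nonadj by blast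
        moreover have "card {u \<in> V j - A j. \<not> adj v u} \<le> card {u \<in> V j. \<not> adj v u}"
          using V \<open>j < q\<close> by (intro card_mono) auto
        ultimately show "real (card {u \<in> V j - A j. \<not> adj v u}) \<le> \<kappa>' * N"
          using \<kappa>'N by linarith
      qed
    qed
    with N0 N(1) have "\<exists>R. (\<forall>j<q. R j \<subseteq> V j - A j \<and> card (R j) = nat \<lceil>\<gamma> * N\<rceil>) \<and>
        tileable q adj (\<lambda>j. V j - A j - R j)"
      by simp
    then obtain R where R: "\<And>j. j < q \<Longrightarrow> R j \<subseteq> V j - A j" "\<And>j. j < q \<Longrightarrow> card (R j) = nat \<lceil>\<gamma> * N\<rceil>"
      "tileable q adj (\<lambda>j. V j - A j - R j)" by blast
    have "tileable q adj (\<lambda>j. R j \<union> (\<Union>S\<in>F. col_set q S j))"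
    proof (rule tileable_absorb_leftover[where V = V and r = "nat \<lceil>\<gamma> * N\<rceil>", OF F(1)])
      show "tileable q adj (col_set q S)" if "S \<in> F" for S
        using F(3)[OF that] absorbs_imp_tileable_col_set by blast
      show "R j \<subseteq> V j \<and> finite (R j) \<and> card (R j) = nat \<lceil>\<gamma> * N\<rceil>" if "j < q" for j
        using R(1,2)[OF that] V that by (meson Diff_subset finite_subset order_trans)
      show "R j \<inter> col_set q S j = {}" if "S \<in> F" "j < q" for S j
        using R(1)[OF that(2)] that(1) by (auto simp: A_def)
      \<comment> \<open>The absorbing capacity was set for \<open>n\<close>, while the leftover is
        measured by the smaller \<open>N\<close>.\<close>
      have "\<gamma> * N \<le> \<gamma> * n" using \<gamma> N(2) by (intro mult_left_mono) auto
      then have "nat \<lceil>\<gamma> * N\<rceil> \<le> nat \<lceil>\<gamma> * n\<rceil>" by (intro nat_mono ceiling_mono)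
      then show "nat \<lceil>\<gamma> * N\<rceil> \<le> card {S \<in> F. absorbs q adj S x}" if "\<And>j. j < q \<Longrightarrow> x j \<in> V j" for x
        using F(6)[OF that] by linarith
    qed (use F(5) in auto)
    then show "tileable q adj V"
    proof (rule tileable_Un[OF R(3)])
      fix j assume "j < q"
      then show "(V j - A j - R j) \<inter> (R j \<union> (\<Union>S\<in>F. col_set q S j)) = {}"
        "V j = (V j - A j - R j) \<union> (R j \<union> (\<Union>S\<in>F. col_set q S j))"
        using R(1) AV unfolding A_def[symmetric] by blast+
    qed
  qed
qed

section \<open>Factors\<close>

text \<open>A bijection onto each class records covering and disjointness together, and gives the
  number of cliques as the size of a class.\<close>

lemma tileable_imp_clique_family:
  assumes "tileable q adj W" "q > 0"
  shows "\<exists>T. finite T \<and> (\<forall>K\<in>T. clique_on q adj K) \<and> (\<forall>i<q. bij_betw (\<lambda>K. K i) T (W i))"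
  using assms
proof (induction rule: tileable.induct)
  case (empty W)
  then show ?case by (intro exI[of _ "{}"]) (simp add: bij_betw_def)
next
  case (insert W' K W)
  then obtain T where T: "finite T" "\<forall>K\<in>T. clique_on q adj K" "\<And>i. i < q \<Longrightarrow> bij_betw (\<lambda>K. K i) T (W' i)"
    by blast
  have "bij_betw (\<lambda>K. K i) (insert K T) (W i)" if "i < q" for i
    using T(3)[OF that] insert.hyps(3,4)[OF that] by (auto simp: bij_betw_def)
  then show ?case
    using T insert.hyps(2) by (intro exI[of _ "insert K T"]) auto
qed

definition clique_graph :: "nat \<Rightarrow> (nat \<Rightarrow> 'a) \<Rightarrow> 'a pair_pre_digraph" where
  "clique_graph q K = \<lparr> pverts = K ` {..<q}, parcs = {(K i, K j) | i j. i < q \<and> j < q \<and> i \<noteq> j} \<rparr>"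

lemma digraph_iso_clique_graph:
  assumes "inj_on K {..<q}"
  shows "digraph_iso (with_proj (complete_graph q)) (with_proj (clique_graph q K))"
proof -
  \<comment> \<open>\<open>complete_graph\<close> numbers its vertices from 1, whereas cliques are
    indexed from 0.\<close>
  define h where "h i = K (i - 1)" for i
  define \<phi> where "\<phi> = \<lparr> iso_verts = h, iso_arcs = map_prod h h, iso_head = snd, iso_tail = fst \<rparr>"
  have inj: "inj_on h {1..q}"
  proof (rule inj_onI)
    fix a b assume "a \<in> {1..q}" "b \<in> {1..q}" "h a = h b"
    moreover from this have "a - 1 = b - 1" by (intro inj_onD[OF assms]) (auto simp: h_def)
    ultimately show "a = b" by auto
  qed
  have wf: "wf_digraph (with_proj (complete_graph q))"
    by unfold_locales (auto simp: complete_graph_def)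
  have "inj_on (map_prod h h) (parcs (complete_graph q))"
    by (rule inj_on_subset[OF map_prod_inj_on[OF inj inj]]) (auto simp: complete_graph_def)
  then have "pre_digraph.digraph_isomorphism (with_proj (complete_graph q)) \<phi>"
    using wf inj by (auto simp: pre_digraph.digraph_isomorphism_def \<phi>_def complete_graph_def)
  moreover have "with_proj (clique_graph q K) = app_iso \<phi> (with_proj (complete_graph q))"
  proof -
    have "h ` {1..q} = K ` {..<q}"
    proof -
      have "{1..q} = Suc ` {..<q}"
        by (simp add: image_Suc_lessThan)
      then show ?thesis by (simp add: image_image h_def)
    qed
    moreover have "map_prod h h ` {(u, v). u \<in> {1..q} \<and> v \<in> {1..q} \<and> u \<noteq> v}
      = {(K i, K j) | i j. i < q \<and> j < q \<and> i \<noteq> j}"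
    proof (intro equalityI subsetI)
      fix e assume "e \<in> map_prod h h ` {(u, v). u \<in> {1..q} \<and> v \<in> {1..q} \<and> u \<noteq> v}"
      then obtain u v where uv: "u \<in> {1..q}" "v \<in> {1..q}" "u \<noteq> v" "e = (h u, h v)" by auto
      then have "u - 1 < q" "v - 1 < q" "u - 1 \<noteq> v - 1" by auto
      with uv show "e \<in> {(K i, K j) | i j. i < q \<and> j < q \<and> i \<noteq> j}" unfolding h_def by blast
    next
      fix e assume "e \<in> {(K i, K j) | i j. i < q \<and> j < q \<and> i \<noteq> j}"
      then obtain i j where "i < q" "j < q" "i \<noteq> j" "e = (K i, K j)" by blast
      then show "e \<in> map_prod h h ` {(u, v). u \<in> {1..q} \<and> v \<in> {1..q} \<and> u \<noteq> v}"
        by (intro image_eqI[of _ _ "(Suc i, Suc j)"]) (auto simp: h_def)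
    qed
    ultimately show ?thesis
      by (simp add: app_iso_def with_proj_def \<phi>_def complete_graph_def clique_graph_def)
  qed
  ultimately show ?thesis
    unfolding digraph_iso_def by blast
qed

text \<open>Since the classes are disjoint, two cliques sharing a vertex share it at the same index,
  and the bijection onto that class makes them equal. So the clique graphs are vertex-disjoint, and
  there are \<open>n\<close> of them.\<close>

lemma tileable_imp_has_factor:
  fixes G :: "'a pair_pre_digraph"
  assumes G: "pair_graph G" and mp: "multipartite G q A" and "q > 0"
    and tile: "tileable q (\<lambda>u v. (u, v) \<in> parcs G) (\<lambda>i. A (Suc i))"
    and cardA: "\<And>i. i \<in> {1..q} \<Longrightarrow> card (A i) = n" and "card (pverts G) = q * n"
  shows "has_factor (complete_graph q) G"
proof -
  obtain T where T: "finite T" "\<And>K. K \<in> T \<Longrightarrow> clique_on q (\<lambda>u v. (u, v) \<in> parcs G) K"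
    "\<And>i. i < q \<Longrightarrow> bij_betw (\<lambda>K. K i) T (A (Suc i))"
    using tileable_imp_clique_family[OF tile \<open>q > 0\<close>] by blast
  have KA: "K i \<in> A (Suc i)" if "K \<in> T" "i < q" for K i
    using T(3)[OF that(2)] that(1) by (auto simp: bij_betw_def)
  have disjA: "i = j" if "i < q" "j < q" "v \<in> A (Suc i)" "v \<in> A (Suc j)" for i j v
  proof (rule ccontr)
    assume "i \<noteq> j"
    then have "A (Suc i) \<inter> A (Suc j) = {}"
      using mp that by (auto simp: multipartite_def disjoint_family_on_def)
    then show False using that by blast
  qed
  have AG: "A (Suc i) \<subseteq> pverts G" if "i < q" for i
    using mp that by (auto simp: multipartite_def)
  have same: "K = K' \<and> i = j" if "K \<in> T" "K' \<in> T" "i < q" "j < q" "K i = K' j" for K K' i j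
  proof -
    have "i = j" using disjA[of i j "K i"] KA that by metis
    then show ?thesis using T(3)[of i] that by (auto simp: bij_betw_def dest: inj_onD)
  qed
  define C where "C = clique_graph q ` T"
  have pv: "pverts (clique_graph q K) = K ` {..<q}" for K by (simp add: clique_graph_def)
  have disj: "K = K'" if "K \<in> T" "K' \<in> T" and ne: "pverts (clique_graph q K) \<inter> pverts (clique_graph q K') \<noteq> {}" for K K'
  proof -
    obtain i j where "i < q" "j < q" "K i = K' j" using ne by (auto simp: pv)
    then show ?thesis using same that by blast
  qed
  \<comment> \<open>\<open>C\<close> is a set of graphs, so counting it by \<open>T\<close> needs
    distinct cliques to give distinct graphs; they do, being disjoint and, as \<open>q > 0\<close>,
    nonempty.\<close>
  have "inj_on (clique_graph q) T"
  proof (rule inj_onI)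
    fix K K' assume "K \<in> T" "K' \<in> T" "clique_graph q K = clique_graph q K'"
    moreover have "pverts (clique_graph q K) \<noteq> {}" using \<open>q > 0\<close> by (auto simp: pv)
    ultimately show "K = K'" by (intro disj) auto
  qed
  then have "card C = card T" by (simp add: C_def card_image)
  also have "card T = n"
    using bij_betw_same_card[OF T(3)[OF \<open>q > 0\<close>]] cardA[of 1] \<open>q > 0\<close> by simp
  finally have cardC: "card C = n" .
  define H where "H = \<lparr> pverts = (\<Union>K\<in>C. pverts K), parcs = (\<Union>K\<in>C. parcs K) \<rparr>"
  have arcs: "parcs H \<subseteq> parcs G"
    using T(2) by (auto simp: H_def C_def clique_graph_def clique_on_def)
  have verts: "pverts H \<subseteq> pverts G"
    using KA AG by (fastforce simp: H_def C_def pv)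
  have wfG: "wf_digraph (with_proj G)"
  proof -
    interpret pair_graph G by (rule G)
    show ?thesis by unfold_locales
  qed
  have wfH: "wf_digraph (with_proj H)"
    by unfold_locales (auto simp: H_def C_def clique_graph_def)
  have sub: "subgraph (with_proj H) (with_proj G)"
    using arcs verts wfG wfH by (simp add: subgraph_def compatible_def)
  have "is_factor (complete_graph q) G H"
    unfolding is_factor_def
  proof (intro conjI sub exI[of _ C] ballI)
    show "finite C" using T(1) by (simp add: C_def)
    show "card C * card (pverts (complete_graph q)) = card (pverts G)"
      using cardC assms(6) by (simp add: complete_graph_def)
    show "digraph_iso (with_proj (complete_graph q)) (with_proj K)" if "K \<in> C" for K
    proof -
      obtain K' where K': "K' \<in> T" "K = clique_graph q K'" using \<open>K \<in> C\<close> by (auto simp: C_def)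
      have "inj_on K' {..<q}" using same[OF K'(1) K'(1)] by (auto intro: inj_onI)
      then show ?thesis using K'(2) digraph_iso_clique_graph by blast
    qed
    show "disjoint_family_on pverts C"
      using disj by (force simp: disjoint_family_on_def C_def)
  qed (simp_all add: H_def)
  then show ?thesis unfolding has_factor_def by blast
qed

section \<open>From the proportional minimum degree to a factor\<close>

text \<open>Since \<open>k_const q + 1 = q - 1 / 2 + harm q / 2\<close>, this is exactly what puts
  \<open>k_const q + 1\<close> above \<open>q\<close>.\<close>

lemma harm_gt_one:
  assumes "q \<ge> 2"
  shows "harm q > (1 :: real)"
proof -
  have "harm 2 \<le> (harm q :: real)" using assms by (rule harm_mono)
  moreover have "harm 2 = (3 / 2 :: real)" by (simp add: harm_def numeral_2_eq_2)
  ultimately show ?thesis by simp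
qed

lemma prop_min_degree_le:
  assumes "i \<in> {1..q}" "j \<in> {1..q}" "i \<noteq> j" "v \<in> A i" "finite (A i)"
  shows "prop_min_degree F q A \<le> real (deg_in F v (A j)) / real (card (A j))"
proof -
  have "prop_min_degree F q A
      \<le> (MIN v\<in>A i. MIN j\<in>{1..q} - {i}. real (deg_in F v (A j)) / real (card (A j)))"
    unfolding prop_min_degree_def using assms by (intro Min_le) auto
  also have "\<dots> \<le> (MIN j\<in>{1..q} - {i}. real (deg_in F v (A j)) / real (card (A j)))"
    using assms by (intro Min_le) auto
  also have "\<dots> \<le> real (deg_in F v (A j)) / real (card (A j))"
    using assms by (intro Min_le) auto
  finally show ?thesis .
qed

theorem theorem3:
  fixes q :: nat
  assumes "q \<ge> 3"
  shows "\<exists>n0::nat. \<forall>n>n0. \<forall>(G :: 'a pair_pre_digraph) A.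
    pair_graph G \<longrightarrow> multipartite G q A \<longrightarrow> balanced q A \<longrightarrow> card (pverts G) = q * n \<longrightarrow>
    prop_min_degree G q A \<ge> k_const q / (k_const q + 1) \<longrightarrow>
    has_factor (complete_graph q) G"
proof -
  define k where "k = k_const q"
  define \<kappa> where "\<kappa> = 1 / (k + 1)"
  have "k + 1 > q"
    using harm_gt_one[of q] assms by (simp add: k_def k_const_def)
  then have \<kappa>: "0 \<le> \<kappa>" "\<kappa> < 1 / q" and k: "k / (k + 1) = 1 - \<kappa>"
    using assms by (auto simp: \<kappa>_def field_simps)
  have "q > 0" using assms by simp
  obtain n0 where n0: "\<forall>n\<ge>n0. \<forall>(V :: nat \<Rightarrow> 'a set) adj. dense_multipartite q adj V n \<kappa> \<longrightarrow> tileable q adj V"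
    using multipartite_tiling[OF \<open>q > 0\<close> \<kappa>] unfolding eventually_sequentially by blast
  show ?thesis
  proof (intro exI[of _ n0] allI impI)
    fix n and G :: "'a pair_pre_digraph" and A
    assume n: "n > n0" and G: "pair_graph G" and mp: "multipartite G q A" and bal: "balanced q A"
      and card: "card (pverts G) = q * n" and deg: "prop_min_degree G q A \<ge> k_const q / (k_const q + 1)"
    interpret pair_graph G by (rule G)
    have fin: "finite (A i)" if "i \<in> {1..q}" for i
      using mp that pair_finite_verts finite_subset[of "A i" "pverts G"]
      by (auto simp: multipartite_def independent_set_def)
    have cardA: "card (A i) = n" if i: "i \<in> {1..q}" for i
    proof -
      have "q * n = card (\<Union>i\<in>{1..q}. A i)"
        using mp card by (simp add: multipartite_def)
      also have "\<dots> = (\<Sum>j\<in>{1..q}. card (A j))"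
        using mp fin by (intro card_UN_disjoint) (auto simp: multipartite_def disjoint_family_on_def)
      also have "\<dots> = (\<Sum>j\<in>{1..q}. card (A i))"
        using bal i unfolding balanced_def by (intro sum.cong refl) blast
      finally show ?thesis using \<open>q > 0\<close> by simp
    qed
    \<comment> \<open>\<open>Suc\<close> passes from the class indices 0 to \<open>q - 1\<close> to
      the indices 1 to \<open>q\<close> of \<open>A\<close>.\<close>
    have "dense_multipartite q (\<lambda>u v. (u, v) \<in> parcs G) (\<lambda>i. A (Suc i)) n \<kappa>"
      unfolding dense_multipartite_def
    proof (intro conjI allI impI ballI)
      show "finite (A (Suc j))" "card (A (Suc j)) = n" if "j < q" for j
        using that fin cardA by simp_all
      show "(v, u) \<in> parcs G" if "(u, v) \<in> parcs G" for u v
        using that pair_sym_arcs by (auto simp: symmetric_def sym_def)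
      fix i j v assume ij: "i < q" "j < q" "i \<noteq> j" and v: "v \<in> A (Suc i)"
      have "1 - \<kappa> \<le> real (deg_in G v (A (Suc j))) / n"
        using prop_min_degree_le[of "Suc i" q "Suc j" v A G] deg k ij v fin cardA by (simp add: k_def)
      then have "(1 - \<kappa>) * n \<le> deg_in G v (A (Suc j))"
        using n by (simp add: field_simps)
      moreover have "deg_in G v (A (Suc j)) + card {u \<in> A (Suc j). (v, u) \<notin> parcs G} = n"
      proof -
        have "card ({u \<in> A (Suc j). (v, u) \<in> parcs G} \<union> {u \<in> A (Suc j). (v, u) \<notin> parcs G})
          = deg_in G v (A (Suc j)) + card {u \<in> A (Suc j). (v, u) \<notin> parcs G}"
          unfolding deg_in_def using fin ij by (intro card_Un_disjoint) auto
        moreover have "{u \<in> A (Suc j). (v, u) \<in> parcs G} \<union> {u \<in> A (Suc j). (v, u) \<notin> parcs G} = A (Suc j)"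
          by auto
        ultimately show ?thesis using cardA ij by simp
      qed
      then have "real (deg_in G v (A (Suc j))) + card {u \<in> A (Suc j). (v, u) \<notin> parcs G} = n"
        by (metis of_nat_add)
      ultimately show "real (card {u \<in> A (Suc j). (v, u) \<notin> parcs G}) \<le> \<kappa> * real n"
        by (simp add: algebra_simps)
    qed
    from n0[rule_format, OF less_imp_le[OF n] this] show "has_factor (complete_graph q) G"
      by (rule tileable_imp_has_factor[OF G mp \<open>q > 0\<close> _ cardA card])
  qed
qed

end
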